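(* Let $k\ge2$ be an integer, $s\in\mathbb{C}\setminus\{1,2,\dots,k\}$ and $\Re v>0$. Then $$\zeta(s,v)=-\sum_{l=1}^{k-1}\frac{(k-l+1)_l}{(s-l)_l}\,\zeta(s-l,v)+\sum_{l=1}^{k}\frac{(k-l+1)_l}{(s-l)_l}\,v^{l-s}+k\sum_{n=0}^\infty(-1)^nG^{(k)}_{n+1}\sum_{j=0}^{n}(-1)^j\binom{n}{j}(j+v)^{-s},$$ and in particular $$\zeta(s)=-\sum_{l=1}^{k-1}\frac{(k-l+1)_l}{(s-l)_l}\,\zeta(s-l)+\frac{k}{s-k}+k\sum_{n=0}^\infty(-1)^nG^{(k)}_{n+1}\sum_{j=0}^{n}(-1)^j\binom{n}{j}(j+1)^{-s}.$$
   Context: $\zeta(s,v)$ is the Hurwitz zeta-function and $\zeta(s)=\zeta(s,1)$ the Riemann zeta-function. $(x)_l=x(x+1)\cdots(x+l-1)$ is the rising factorial. Gregory's coefficients of higher order are $G^{(k)}_n=\frac{1}{n!}\sum_{l=1}^{n}\frac{S_1(n,l)}{l+k}$, where the (signed) Stirling numbers of the first kind $S_1(n,l)$ are defined by $x(x-1)\cdots(x-n+1)=\sum_{l=1}^nS_1(n,l)x^l$. *)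

theory Defs
  imports "HOL-Complex_Analysis.Complex_Analysis" "HOL-Computational_Algebra.Polynomial"
begin

text \<open>
  The Hurwitz zeta-function, for \<open>Re v > 0\<close>: the analytic continuation in \<open>s\<close> to the
  complex plane without \<open>1\<close> of the series over \<open>(n + v) powr (-s)\<close> (principal powers), which
  converges for \<open>Re s > 1\<close>.  The clause \<open>f 1 = 0\<close> fixes an arbitrary value at the pole, so that
  the continuation is a unique function on the whole type.
\<close>
definition hurwitz_zeta :: "complex \<Rightarrow> complex \<Rightarrow> complex" where
  "hurwitz_zeta s v =
     (THE f. f holomorphic_on (- {1}) \<and> f 1 = 0 \<and>
        (\<forall>z. Re z > 1 \<longrightarrow> (\<lambda>n. (of_nat n + v) powr (- z)) sums f z)) s"

definition riemann_zeta :: "complex \<Rightarrow> complex" where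
  "riemann_zeta s = hurwitz_zeta s 1"

text \<open>Signed, unlike the library constant \<open>stirling\<close>: the coefficient of \<open>x ^ l\<close> in
  \<open>x (x - 1) \<dots> (x - n + 1)\<close>.\<close>
definition signed_stirling1 :: "nat \<Rightarrow> nat \<Rightarrow> int" where
  "signed_stirling1 n l = coeff (\<Prod>i<n. [:- int i, 1:]) l"

definition gregory_coeff :: "nat \<Rightarrow> nat \<Rightarrow> real" where
  "gregory_coeff k n =
     1 / fact n * (\<Sum>l=1..n. of_int (signed_stirling1 n l) / (real l + real k))"

end

theory Submission
  imports Defs
begin

text \<open>
  For \<open>x = 1 - exp (- u)\<close>, integrating the binomial series of \<open>(1 - x) powr t\<close> against
  \<open>t ^ (k - 1)\<close> over \<open>[0, 1]\<close> shows that the Gregory coefficients generate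
  \<open>(1 - \<phi> u) / (1 - exp (- u))\<close>, where \<open>\<phi> u\<close> is \<open>k\<close> times the integral of
  \<open>t ^ (k - 1) * exp (- t u)\<close>, an elementary function. Multiplying by
  \<open>u powr (s - 1) * exp (- v u)\<close> and integrating over \<open>u > 0\<close> gives \<open>\<Gamma> s\<close> times the series of
  finite differences; expanding \<open>1 / (1 - exp (- u))\<close> geometrically instead gives the zeta values.
  This settles \<open>Re s > k + 1\<close>, and the case \<open>k = 1\<close> already provides the analytic continuation
  of the Hurwitz zeta-function. The series of finite differences is entire in \<open>s\<close>, because its
  coefficients are nonnegative and summable while the differences are bounded locally uniformly in
  \<open>s\<close>; the identity theorem does the rest.
\<close>

section \<open>Mellin transform of the exponential\<close>

text \<open>Dominated convergence for partial sums. Only the partial sums need a common integrable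
  bound, not the series of norms; every termwise integration below goes through this form.\<close>

lemma has_integral_sums_dominated:
  fixes f :: "nat \<Rightarrow> real \<Rightarrow> 'a::euclidean_space"
  assumes "\<And>n. (f n has_integral I n) S" and "h integrable_on S"
    and "\<And>n x. x \<in> S \<Longrightarrow> norm (\<Sum>i<n. f i x) \<le> h x"
    and "\<And>x. x \<in> S \<Longrightarrow> (\<lambda>n. f n x) sums g x"
  shows "g integrable_on S" "I sums integral S g"
proof -
  have int: "((\<lambda>x. \<Sum>i<n. f i x) has_integral (\<Sum>i<n. I i)) S" for n
    by (intro has_integral_sum) (use assms(1) in auto)
  have conv: "(\<lambda>n. \<Sum>i<n. f i x) \<longlonglongrightarrow> g x" if "x \<in> S" for x
    using assms(4)[OF that] by (simp add: sums_def)
  note dc = dominated_convergence[of "\<lambda>n x. \<Sum>i<n. f i x" S h g, OF _ assms(2,3) conv]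
  show "g integrable_on S"
    by (rule dc(1)) (use int in auto)
  have "(\<lambda>n. integral S (\<lambda>x. \<Sum>i<n. f i x)) \<longlonglongrightarrow> integral S g"
    by (rule dc(2)) (use int in auto)
  thus "I sums integral S g"
    unfolding sums_def using integral_unique[OF int] by simp
qed

text \<open>The half-line is invariant under scaling by \<open>c\<close>, so the substitution can be
  done on boxes for the extension of \<open>f\<close> by zero and then passed to the limit.\<close>

lemma has_integral_scale_greaterThan_0:
  fixes f :: "real \<Rightarrow> 'a::banach"
  assumes f: "(f has_integral I) {0<..}" and c: "c > 0"
  shows "((\<lambda>x. f (c * x)) has_integral (I /\<^sub>R c)) {0<..}"
proof -
  define F where "F = (\<lambda>x. if x \<in> {0<..} then f x else 0)"
  have F_scale: "(\<lambda>x. if x \<in> {0<..} then f (c * x) else 0) = (\<lambda>x. F (c * x))"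
    using c by (auto simp: F_def fun_eq_iff zero_less_mult_iff)
  have alt: "F integrable_on cbox a b" for a b
    using f unfolding has_integral_alt'[of f] F_def by blast
  have scaled: "((\<lambda>x. F (c * x)) has_integral (integral (cbox (c * a) (c * b)) F /\<^sub>R c)) (cbox a b)"
    for a b
    using has_integral_affinity'[where c = 0, OF integrable_integral[OF alt[of "c * a" "c * b"]] c] c
    by (simp add: field_simps)
  show ?thesis
    unfolding has_integral_alt'[of "\<lambda>x. f (c * x)"] F_scale
  proof (intro conjI allI impI)
    show "(\<lambda>x. F (c * x)) integrable_on cbox a b" for a b
      using scaled by blast
    fix e :: real assume "e > 0"
    \<comment> \<open>Rescaling divides the error by \<open>c\<close>, so the tolerance is taken as
      \<open>e * c\<close>; a ball of radius \<open>B / c\<close> scales onto one of radius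
      \<open>B\<close>.\<close>
    then obtain B where B: "B > 0"
      "\<And>a b. ball 0 B \<subseteq> cbox a b \<Longrightarrow> norm (integral (cbox a b) F - I) < e * c"
      using f c unfolding has_integral_alt'[of f] F_def by (meson mult_pos_pos)
    show "\<exists>B>0. \<forall>a b. ball 0 B \<subseteq> cbox a b \<longrightarrow>
        norm (integral (cbox a b) (\<lambda>x. F (c * x)) - I /\<^sub>R c) < e"
    proof (intro exI[of _ "B / c"] conjI allI impI)
      show "B / c > 0" using B c by simp
      fix a b :: real assume ab: "ball 0 (B / c) \<subseteq> cbox a b"
      have "ball 0 B \<subseteq> cbox (c * a) (c * b)"
      proof
        fix x :: real assume "x \<in> ball 0 B"
        hence "x / c \<in> ball 0 (B / c)" using c by (simp add: field_simps)
        hence "x / c \<in> cbox a b" using ab by blast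
        thus "x \<in> cbox (c * a) (c * b)" using c by (simp add: field_simps)
      qed
      from B(2)[OF this] have *: "norm (integral (cbox (c * a) (c * b)) F - I) < e * c" .
      have "integral (cbox a b) (\<lambda>x. F (c * x)) - I /\<^sub>R c
          = (integral (cbox (c * a) (c * b)) F - I) /\<^sub>R c"
        using integral_unique[OF scaled] by (simp add: scaleR_diff_right)
      hence "norm (integral (cbox a b) (\<lambda>x. F (c * x)) - I /\<^sub>R c)
          = norm (integral (cbox (c * a) (c * b)) F - I) / c"
        using c by (simp only: norm_scaleR) (simp add: field_simps)
      also have "\<dots> < e" using * c by (simp add: field_simps)
      finally show "norm (integral (cbox a b) (\<lambda>x. F (c * x)) - I /\<^sub>R c) < e" .
    qed
  qed
qed

text \<open>Substitute \<open>a * u\<close> for \<open>u\<close> in Euler's integral. For positive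
  real \<open>a\<close> the principal powers multiply without correction, and the prefactor
  \<open>a powr (1 - s)\<close> restores the integrand.\<close>

lemma Gamma_integral_scaled_complex:
  assumes s: "Re s > 0" and a: "a > (0::real)"
  shows "((\<lambda>u. of_real u powr (s - 1) * exp (- (of_real a * of_real u)))
           has_integral (Gamma s * of_real a powr (- s))) {0<..}"
proof -
  have "((\<lambda>u. of_real a powr (1 - s) *
          (of_real (a * u) powr (s - 1) / of_real (exp (a * u))))
        has_integral (of_real a powr (1 - s) * (Gamma s /\<^sub>R a))) {0<..}"
    by (intro has_integral_mult_right has_integral_scale_greaterThan_0[OF Gamma_integral_complex' a] s)
  also have "of_real a powr (1 - s) * (Gamma s /\<^sub>R a) = Gamma s * of_real a powr (- s)"
    using a powr_diff[of "complex_of_real a" 1 s]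
    by (simp add: scaleR_conv_of_real field_simps powr_minus)
  finally show ?thesis
  proof (rule has_integral_eq[rotated])
    fix u :: real assume u: "u \<in> {0<..}"
    have "complex_of_real a powr (1 - s) * complex_of_real a powr (s - 1) = 1"
      using a by (simp flip: powr_add)
    thus "of_real a powr (1 - s) * (of_real (a * u) powr (s - 1) / of_real (exp (a * u)))
        = of_real u powr (s - 1) * exp (- (of_real a * complex_of_real u))"
      using u a by (simp add: powr_times_real exp_minus field_simps flip: exp_of_real)
  qed
qed

lemma Gamma_integral_scaled_real:
  assumes s: "s > 0" and a: "a > (0::real)"
  shows "((\<lambda>u. u powr (s - 1) * exp (- (a * u))) has_integral (Gamma s * a powr (- s))) {0<..}"
proof -
  have "((\<lambda>u. Re (of_real u powr (of_real s - 1) * exp (- (of_real a * of_real u))))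
           has_integral Re (Gamma (of_real s) * of_real a powr (- of_real s))) {0<..}"
    using has_integral_linear[OF Gamma_integral_scaled_complex[of "of_real s" a] bounded_linear_Re] s a
    by (simp add: o_def)
  also have "Re (Gamma (of_real s) * of_real a powr (- of_real s)) = Gamma s * a powr (- s)"
    using a by (simp add: Gamma_complex_of_real powr_of_real flip: of_real_minus)
  finally show ?thesis
  proof (rule has_integral_eq[rotated])
    fix u :: real assume u: "u \<in> {0<..}"
    have "of_real u powr (of_real s - 1) * exp (- (of_real a * of_real u))
      = complex_of_real (u powr (s - 1) * exp (- (a * u)))"
      using u powr_of_real[of u "s - 1"] by (simp add: exp_of_real[symmetric])
    thus "Re (of_real u powr (of_real s - 1) * exp (- (of_real a * of_real u)))
      = u powr (s - 1) * exp (- (a * u))" by (metis Re_complex_of_real)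
  qed
qed

text \<open>The modulus is the integrand of a real Gamma integral, which supplies the dominating
  functions.\<close>

lemma norm_powr_times_exp:
  assumes "u > 0"
  shows "norm (of_real u powr (s - 1) * exp (- (v * complex_of_real u)))
    = u powr (Re s - 1) * exp (- (Re v * u))"
  using assms by (simp add: norm_mult norm_powr_real_powr)

text \<open>Writing \<open>v = a + w\<close> with \<open>a\<close> real and \<open>\<bar>w\<bar> < a\<close>, the expansion of \<open>exp (- w u)\<close> integrates
  termwise to the binomial series of \<open>(1 + w / a) powr (- s)\<close>.\<close>
lemma Gamma_integral_scaled:
  assumes s: "Re s > 0" and v: "Re v > 0"
  shows "((\<lambda>u. of_real u powr (s - 1) * exp (- (v * of_real u)))
           has_integral (Gamma s * v powr (- s))) {0<..}"
proof -
  \<comment> \<open>The disc of radius \<open>a\<close> about \<open>a\<close> contains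
    \<open>v\<close> iff \<open>2 * a * Re v\<close> exceeds the square of \<open>norm v\<close>;
    adding 1 makes this strict.\<close>
  define a where "a = (norm v)\<^sup>2 / (2 * Re v) + 1"
  define w where "w = v - of_real a"
  have a: "a > 0" using v unfolding a_def by (simp add: add_nonneg_pos)
  have "(norm w)\<^sup>2 = (norm v)\<^sup>2 - 2 * a * Re v + a\<^sup>2"
    unfolding w_def cmod_power2 by (simp add: power2_eq_square algebra_simps)
  also have "2 * a * Re v = (norm v)\<^sup>2 + 2 * Re v"
    using v by (simp add: a_def field_simps)
  finally have "(norm w)\<^sup>2 < a\<^sup>2" using v by simp
  hence w: "norm w < a" using a by (simp add: power2_less_imp_less)
  define f where "f = (\<lambda>n u. of_real u powr (s - 1) * exp (- (of_real a * of_real u))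
      * ((- w * complex_of_real u) ^ n / fact n))"
  define I where "I = (\<lambda>n. Gamma s * of_real a powr (- s) * (((- s) gchoose n) * (w / of_real a) ^ n))"
  \<comment> \<open>Partial sums of the expansion grow at most like \<open>exp (norm w * u)\<close>,
    and the decay \<open>exp (- (a * u))\<close> wins because \<open>norm w < a\<close>.\<close>
  define h where "h = (\<lambda>u. u powr (Re s - 1) * exp (- ((a - norm w) * u)))"
  have nz: "s \<notin> \<int>\<^sub>\<le>\<^sub>0" using s by (auto elim!: nonpos_Ints_cases)
  \<comment> \<open>The factor \<open>u ^ n\<close> raises \<open>s\<close> to \<open>s + n\<close>,
    and the quotient of Gamma values is a Pochhammer symbol, hence a binomial coefficient of
    \<open>- s\<close> up to sign.\<close>
  have int: "(f n has_integral I n) {0<..}" for n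
  proof -
    have "((\<lambda>u. (- w) ^ n / fact n * (of_real u powr (s + of_nat n - 1) * exp (- (of_real a * of_real u))))
       has_integral ((- w) ^ n / fact n * (Gamma (s + of_nat n) * of_real a powr (- (s + of_nat n))))) {0<..}"
      by (intro has_integral_mult_right Gamma_integral_scaled_complex) (use s a in auto)
    also have "(- w) ^ n / fact n * (Gamma (s + of_nat n) * of_real a powr (- (s + of_nat n))) = I n"
    proof -
      have "Gamma (s + of_nat n) = Gamma s * pochhammer s n"
        using pochhammer_Gamma[OF nz, of n] Gamma_eq_zero_iff[of s] nz by simp
      moreover have "complex_of_real a powr (- (s + of_nat n)) = of_real a powr (- s) / of_real a ^ n"
        using a by (simp add: powr_diff powr_nat')
      moreover have "(- s) gchoose n = (-1) ^ n * pochhammer s n / fact n"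
        by (simp add: gbinomial_pochhammer)
      ultimately show ?thesis
        by (simp add: I_def power_minus[of w] power_divide)
    qed
    finally show ?thesis
    proof (rule has_integral_eq[rotated])
      fix u :: real assume "u \<in> {0<..}"
      hence "complex_of_real u powr (s + of_nat n - 1) = of_real u powr (s - 1) * of_real u ^ n"
        using powr_add[of "complex_of_real u" "s - 1" "of_nat n"]
        by (simp add: algebra_simps powr_nat')
      thus "(- w) ^ n / fact n * (of_real u powr (s + of_nat n - 1) * exp (- (of_real a * of_real u))) = f n u"
        by (simp add: f_def power_mult_distrib power_minus[of w] power_minus[of "w * _"])
    qed
  qed
  have h: "h integrable_on {0<..}"
    using Gamma_integral_scaled_real[of "Re s" "a - norm w"] s w unfolding h_def by auto
  have bound: "norm (\<Sum>i<n. f i u) \<le> h u" if u: "u \<in> {0<..}" for n u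
  proof -
    have "norm (\<Sum>i<n. f i u) \<le> (\<Sum>i<n. norm (f i u))" by (rule norm_sum)
    also have "\<dots> = u powr (Re s - 1) * exp (- (a * u)) * (\<Sum>i<n. (norm w * u) ^ i / fact i)"
      using u norm_powr_times_exp[of u s "of_real a"]
      by (simp add: f_def norm_mult norm_power norm_divide sum_distrib_left)
    also have "(\<Sum>i<n. (norm w * u) ^ i / fact i) \<le> exp (norm w * u)"
    proof -
      have "(\<lambda>i. (norm w * u) ^ i / fact i) sums exp (norm w * u)"
        using exp_converges[of "norm w * u"] by (simp add: divide_inverse mult.commute)
      thus ?thesis
        using sum_le_suminf[of "\<lambda>i. (norm w * u) ^ i / fact i" "{..<n}"] u
        by (simp add: sums_iff)
    qed
    also have "u powr (Re s - 1) * exp (- (a * u)) * exp (norm w * u) = h u"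
      by (simp add: h_def mult.assoc algebra_simps flip: exp_add)
    finally show ?thesis by (simp add: mult_left_mono)
  qed
  have sums: "(\<lambda>n. f n u) sums (of_real u powr (s - 1) * exp (- (v * of_real u)))" for u
  proof -
    have "(\<lambda>n. f n u) sums (of_real u powr (s - 1) * exp (- (of_real a * of_real u)) * exp (- w * of_real u))"
      unfolding f_def using exp_converges[of "- w * complex_of_real u"]
      by (intro sums_mult) (simp add: scaleR_conv_of_real divide_inverse mult.commute)
    also have "of_real u powr (s - 1) * exp (- (of_real a * of_real u)) * exp (- w * of_real u)
      = of_real u powr (s - 1) * exp (- (v * of_real u))"
      by (simp add: w_def mult.assoc algebra_simps flip: exp_add)
    finally show ?thesis .
  qed
  note main = has_integral_sums_dominated[OF int h bound sums]
  have "I sums (Gamma s * of_real a powr (- s) * (1 + w / of_real a) powr (- s))"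
    unfolding I_def using w a by (intro sums_mult gen_binomial_complex) (simp add: norm_divide)
  also have "Gamma s * of_real a powr (- s) * (1 + w / of_real a) powr (- s) = Gamma s * v powr (- s)"
  proof -
    \<comment> \<open>The principal power of this product splits because \<open>a\<close> is a
      positive real.\<close>
    have "v = of_real a * (1 + w / of_real a)" using a by (simp add: w_def field_simps)
    hence "v powr (- s) = of_real a powr (- s) * (1 + w / of_real a) powr (- s)"
      using a powr_times_real_left[of "of_real a" "1 + w / of_real a" "- s"] by simp
    thus ?thesis by simp
  qed
  finally have I: "I sums (Gamma s * v powr (- s))" .
  have "integral {0<..} (\<lambda>u. of_real u powr (s - 1) * exp (- (v * of_real u))) = Gamma s * v powr (- s)"
    by (rule sums_unique2[OF main(2) I])
  thus ?thesis
    using integrable_integral[OF main(1)] by simp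
qed

section \<open>Finite differences of complex powers\<close>

text \<open>Up to the sign \<open>(-1) ^ n\<close>, the \<open>n\<close>-th forward difference with
  step 1 of \<open>x powr (- s)\<close> at \<open>x = v\<close>.\<close>

definition zeta_diff :: "nat \<Rightarrow> complex \<Rightarrow> complex \<Rightarrow> complex" where
  "zeta_diff n s v = (\<Sum>j=0..n. (-1) ^ j * of_nat (n choose j) * (of_nat j + v) powr (- s))"

text \<open>Binomial expansion of \<open>(1 - exp (- u)) ^ n\<close>: the factor
  \<open>exp (- u) ^ j\<close> moves \<open>v\<close> to \<open>j + v\<close>.\<close>

lemma has_integral_zeta_diff:
  assumes s: "Re s > 0" and v: "Re v > 0"
  shows "((\<lambda>u. of_real u powr (s - 1) * exp (- (v * of_real u)) * of_real ((1 - exp (- u)) ^ n))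
           has_integral (Gamma s * zeta_diff n s v)) {0<..}"
proof -
  have "((\<lambda>u. \<Sum>j=0..n. (-1) ^ j * of_nat (n choose j) *
          (of_real u powr (s - 1) * exp (- ((of_nat j + v) * of_real u))))
        has_integral (\<Sum>j=0..n. (-1) ^ j * of_nat (n choose j) * (Gamma s * (of_nat j + v) powr (- s)))) {0<..}"
    by (intro has_integral_sum has_integral_mult_right Gamma_integral_scaled)
       (use s v in \<open>auto intro: add_nonneg_pos\<close>)
  also have "(\<Sum>j=0..n. (-1) ^ j * of_nat (n choose j) * (Gamma s * (of_nat j + v) powr (- s)))
      = Gamma s * zeta_diff n s v"
    by (simp add: zeta_diff_def sum_distrib_left mult_ac)
  finally show ?thesis
  proof (rule has_integral_eq[rotated])
    fix u :: real
    have "complex_of_real ((1 - exp (- u)) ^ n) = (- exp (- of_real u) + 1) ^ n"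
      by (simp add: exp_of_real[symmetric])
    also have "\<dots> = (\<Sum>j=0..n. of_nat (n choose j) * (- exp (- of_real u)) ^ j)"
      by (subst binomial_ring) (simp add: atLeast0AtMost)
    also have "of_real u powr (s - 1) * exp (- (v * of_real u)) * \<dots>
       = (\<Sum>j=0..n. (-1) ^ j * of_nat (n choose j) *
          (of_real u powr (s - 1) * exp (- ((of_nat j + v) * of_real u))))"
      unfolding sum_distrib_left
    proof (intro sum.cong refl)
      fix j
      have "exp (- ((of_nat j + v) * of_real u)) = exp (- (v * of_real u)) * exp (- complex_of_real u) ^ j"
        by (simp add: exp_of_nat_mult[symmetric] ring_distribs exp_add[symmetric] add_ac)
      moreover have "(- exp (- complex_of_real u)) ^ j = (-1) ^ j * exp (- complex_of_real u) ^ j"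
        by (rule power_minus)
      ultimately show "of_real u powr (s - 1) * exp (- (v * of_real u)) *
           (of_nat (n choose j) * (- exp (- of_real u)) ^ j) =
         (-1) ^ j * of_nat (n choose j) *
          (of_real u powr (s - 1) * exp (- ((of_nat j + v) * of_real u)))"
        by (simp add: mult_ac)
    qed
    finally show "(\<Sum>j=0..n. (-1) ^ j * of_nat (n choose j) *
          (of_real u powr (s - 1) * exp (- ((of_nat j + v) * of_real u)))) =
        of_real u powr (s - 1) * exp (- (v * of_real u)) * of_real ((1 - exp (- u)) ^ n)" ..
  qed
qed

text \<open>The left side is a single term of the expansion of
  \<open>(x + (1 - x)) ^ (n + p) = 1\<close>, all of whose terms are nonnegative.\<close>

lemma binomial_term_le_1:
  fixes x :: real
  assumes "0 \<le> x" "x \<le> 1"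
  shows "real ((n + p) choose p) * (x ^ p * (1 - x) ^ n) \<le> 1"
proof -
  have "(x + (1 - x)) ^ (n + p) = (\<Sum>i\<le>n + p. real ((n + p) choose i) * x ^ i * (1 - x) ^ (n + p - i))"
    by (rule binomial_ring)
  hence "1 = (\<Sum>i\<le>n + p. real ((n + p) choose i) * x ^ i * (1 - x) ^ (n + p - i))" by simp
  also have "\<dots> \<ge> (\<Sum>i\<in>{p}. real ((n + p) choose i) * x ^ i * (1 - x) ^ (n + p - i))"
    using assms by (intro sum_mono2) auto
  finally show ?thesis by (simp add: mult_ac)
qed

text \<open>Shifting \<open>v\<close> by \<open>p\<close> contributes \<open>exp (- u) ^ p\<close>
  to the integrand. Together with \<open>(1 - exp (- u)) ^ n\<close> and the binomial weight this
  stays below 1, leaving a bound independent of \<open>n\<close> and \<open>p\<close>.\<close>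

lemma zeta_diff_bound:
  assumes s: "Re s > 0" and v: "Re v > 0"
  shows "norm (zeta_diff n s (v + of_nat p)) * real ((n + p) choose p)
    \<le> Gamma (Re s) * Re v powr (- Re s) / norm (Gamma s)"
proof -
  define c where "c = real ((n + p) choose p)"
  define f where "f = (\<lambda>u. of_real c * (of_real u powr (s - 1) * exp (- ((v + of_nat p) * of_real u))
    * complex_of_real ((1 - exp (- u)) ^ n)))"
  have f: "(f has_integral (of_real c * (Gamma s * zeta_diff n s (v + of_nat p)))) {0<..}"
    unfolding f_def using s v
    by (intro has_integral_mult_right has_integral_zeta_diff) (auto intro: add_pos_nonneg)
  note h = Gamma_integral_scaled_real[OF s v]
  have "norm (f u) \<le> u powr (Re s - 1) * exp (- (Re v * u))" if u: "u > 0" for u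
  proof -
    have "norm (f u) = c * (u powr (Re s - 1) * exp (- ((Re v + p) * u)) * (1 - exp (- u)) ^ n)"
      using norm_powr_times_exp[OF u, of s "v + of_nat p"] u
      by (simp add: f_def norm_mult c_def del: of_real_power of_real_diff)
    also have "exp (- ((Re v + p) * u)) = exp (- (Re v * u)) * exp (- u) ^ p"
      by (simp add: exp_of_nat_mult[symmetric] ring_distribs exp_add[symmetric] exp_diff)
    also have "c * (u powr (Re s - 1) * (exp (- (Re v * u)) * exp (- u) ^ p) * (1 - exp (- u)) ^ n)
      = u powr (Re s - 1) * exp (- (Re v * u)) * (c * (exp (- u) ^ p * (1 - exp (- u)) ^ n))"
      by (simp add: mult_ac)
    also have "\<dots> \<le> u powr (Re s - 1) * exp (- (Re v * u)) * 1"
      unfolding c_def using u by (intro mult_left_mono binomial_term_le_1) auto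
    finally show ?thesis by simp
  qed
  hence "norm (integral {0<..} f) \<le> integral {0<..} (\<lambda>u. u powr (Re s - 1) * exp (- (Re v * u)))"
    using f h by (intro integral_norm_bound_integral) auto
  hence "c * (norm (Gamma s) * norm (zeta_diff n s (v + of_nat p))) \<le> Gamma (Re s) * Re v powr (- Re s)"
    using integral_unique[OF f] integral_unique[OF h] by (simp add: norm_mult c_def)
  moreover have "Gamma s \<noteq> 0"
    using s by (auto simp: Gamma_eq_zero_iff elim!: nonpos_Ints_cases)
  ultimately show ?thesis by (simp add: c_def field_simps)
qed

section \<open>Bounds for finite differences, locally uniform in the exponent\<close>

text \<open>One factor \<open>j + v\<close> is split off each power, and \<open>j\<close> is
  absorbed into the binomial coefficient. This carries estimates from \<open>s\<close> to
  \<open>s - 1\<close>. At \<open>n = 0\<close> the truncated \<open>n - 1\<close> is harmless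
  because its factor is 0.\<close>

lemma zeta_diff_shift:
  assumes v: "Re v > 0"
  shows "zeta_diff n (s - 1) v = v * zeta_diff n s v - of_nat n * zeta_diff (n - 1) s (v + 1)"
proof -
  have "zeta_diff n (s - 1) v =
      (\<Sum>j=0..n. (-1) ^ j * of_nat (n choose j) * ((of_nat j + v) * (of_nat j + v) powr (- s)))"
    unfolding zeta_diff_def
  proof (intro sum.cong refl)
    fix j
    have "of_nat j + v \<noteq> 0" using v by (auto simp: complex_eq_iff)
    thus "(-1) ^ j * of_nat (n choose j) * (of_nat j + v) powr (- (s - 1)) =
      (-1) ^ j * of_nat (n choose j) * ((of_nat j + v) * (of_nat j + v) powr (- s))"
      using powr_add[of "of_nat j + v" 1 "- s"] by simp
  qed
  also have "\<dots> = v * zeta_diff n s v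
      + (\<Sum>j=0..n. (-1) ^ j * of_nat (j * (n choose j)) * (of_nat j + v) powr (- s))"
    by (simp add: zeta_diff_def sum_distrib_left ring_distribs sum.distrib mult_ac)
  also have "(\<Sum>j=0..n. (-1) ^ j * of_nat (j * (n choose j)) * (of_nat j + v) powr (- s))
      = - (of_nat n * zeta_diff (n - 1) s (v + 1))"
  proof (cases n)
    case (Suc m)
    have "(\<Sum>j=0..Suc m. (-1) ^ j * of_nat (j * (Suc m choose j)) * (of_nat j + v) powr (- s))
      = (\<Sum>j=0..m. (-1) ^ Suc j * of_nat (Suc j * (Suc m choose Suc j)) * (of_nat (Suc j) + v) powr (- s))"
      by (subst sum.atLeast0_atMost_Suc_shift) (simp del: of_nat_mult of_nat_Suc binomial_Suc_Suc power_Suc)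
    also have "\<dots> = - (of_nat (Suc m) * zeta_diff m s (v + 1))"
      unfolding zeta_diff_def sum_distrib_left sum_negf[symmetric]
    proof (intro sum.cong refl)
      fix j
      have "Suc j * (Suc m choose Suc j) = Suc m * (m choose j)"
        using binomial_absorption[of j "Suc m"] by simp
      moreover have "of_nat (Suc j) + v = of_nat j + (v + 1)" by simp
      ultimately show "(-1) ^ Suc j * of_nat (Suc j * (Suc m choose Suc j)) * (of_nat (Suc j) + v) powr (- s)
        = - (of_nat (Suc m) * ((-1) ^ j * of_nat (m choose j) * (of_nat j + (v + 1)) powr (- s)))"
        by (simp only: of_nat_mult power_Suc) (simp only: mult_ac mult_minus_left mult_minus_right mult_1)
    qed
    finally show ?thesis using Suc by simp
  qed simp
  finally show ?thesis by simp
qed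

text \<open>The recurrence \<open>zeta_diff_shift\<close> costs a factor \<open>n\<close>, which the improved decay at \<open>v + 1\<close>
  compensates; hence the weight \<open>(n + p) choose p\<close>, of order \<open>n ^ p\<close>.\<close>
lemma zeta_diff_weighted_bound:
  assumes v: "Re v > 0" and K: "compact K" "K \<subseteq> {s. Re s > - real m}"
  shows "\<exists>B. \<forall>n. \<forall>s\<in>K. norm (zeta_diff n s (v + of_nat p)) * real ((n + p) choose p) \<le> B"
  using K
proof (induction m arbitrary: K p)
  case 0
  \<comment> \<open>In the right half-plane the bound of \<open>zeta_diff_bound\<close> is
    continuous in \<open>s\<close>, hence bounded on compact sets.\<close>
  have "continuous_on K (\<lambda>s. Gamma (Re s) * Re v powr (- Re s) / norm (Gamma s))"
  proof (intro continuous_intros)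
    have pos: "Re s > 0" if "s \<in> K" for s using that 0 by auto
    hence nz: "s \<notin> \<int>\<^sub>\<le>\<^sub>0" if "s \<in> K" for s
      using that by (fastforce elim!: nonpos_Ints_cases)
    have "continuous_on {0<..} (Gamma :: real \<Rightarrow> real)"
      by (intro continuous_on_Gamma) (auto elim!: nonpos_Ints_cases)
    thus "continuous_on K (\<lambda>s. Gamma (Re s))"
      by (rule continuous_on_compose2) (use pos in \<open>auto intro: continuous_intros\<close>)
    show "K \<inter> \<int>\<^sub>\<le>\<^sub>0 = {}" using nz by blast
    show "\<forall>s\<in>K. norm (Gamma s) \<noteq> 0" using nz by (simp add: Gamma_eq_zero_iff)
  qed (use v in auto)
  hence "bounded ((\<lambda>s. Gamma (Re s) * Re v powr (- Re s) / norm (Gamma s)) ` K)"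
    using 0 by (intro compact_imp_bounded compact_continuous_image)
  then obtain B where
    B': "\<forall>x\<in>(\<lambda>s. Gamma (Re s) * Re v powr (- Re s) / norm (Gamma s)) ` K. norm x \<le> B"
    unfolding bounded_iff by blast
  have B: "Gamma (Re s) * Re v powr (- Re s) / norm (Gamma s) \<le> B" if "s \<in> K" for s
    using B'[THEN bspec, OF imageI[OF that]] unfolding real_norm_def by (rule abs_le_D1)
  have "norm (zeta_diff n s (v + of_nat p)) * real ((n + p) choose p) \<le> B" if "s \<in> K" for n s
    using zeta_diff_bound[of s v n p] B[OF that] 0 that v by fastforce
  thus ?case by blast
next
  case (Suc m)
  \<comment> \<open>The translate lies in the half-plane of the induction hypothesis, which is used
    with both \<open>p\<close> and \<open>Suc p\<close>.\<close>
  define K' where "K' = (\<lambda>s. 1 + s) ` K"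
  have K': "compact K'" "K' \<subseteq> {s. Re s > - real m}"
    using Suc.prems unfolding K'_def by (auto intro!: compact_translation)
  obtain B1 where B1: "\<And>n s. s \<in> K' \<Longrightarrow>
      norm (zeta_diff n s (v + of_nat p)) * real ((n + p) choose p) \<le> B1"
    using Suc.IH[OF K', of p] by blast
  obtain B2 where B2: "\<And>n s. s \<in> K' \<Longrightarrow>
      norm (zeta_diff n s (v + of_nat (Suc p))) * real ((n + Suc p) choose Suc p) \<le> B2"
    using Suc.IH[OF K', of "Suc p"] by blast
  have "norm (zeta_diff n s (v + of_nat p)) * real ((n + p) choose p)
      \<le> norm (v + of_nat p) * B1 + real (Suc p) * \<bar>B2\<bar>" if s: "s \<in> K" for n s
  proof -
    have s': "1 + s \<in> K'" using s by (simp add: K'_def)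
    define c where "c = real ((n + p) choose p)"
    have "zeta_diff n s (v + of_nat p) = (v + of_nat p) * zeta_diff n (1 + s) (v + of_nat p)
        - of_nat n * zeta_diff (n - 1) (1 + s) (v + of_nat (Suc p))"
      using zeta_diff_shift[of "v + of_nat p" n "1 + s"] v by (simp add: add_ac add_pos_nonneg)
    also have "norm \<dots> \<le> norm (v + of_nat p) * norm (zeta_diff n (1 + s) (v + of_nat p))
        + real n * norm (zeta_diff (n - 1) (1 + s) (v + of_nat (Suc p)))"
      by (rule order.trans[OF norm_triangle_ineq4]) (simp add: norm_mult)
    finally have "norm (zeta_diff n s (v + of_nat p)) * c \<le>
        (norm (v + of_nat p) * norm (zeta_diff n (1 + s) (v + of_nat p))
        + real n * norm (zeta_diff (n - 1) (1 + s) (v + of_nat (Suc p)))) * c"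
      by (rule mult_right_mono) (simp add: c_def)
    also have "\<dots> = norm (v + of_nat p) * (norm (zeta_diff n (1 + s) (v + of_nat p)) * c)
        + norm (zeta_diff (n - 1) (1 + s) (v + of_nat (Suc p))) * (real n * c)"
      by (simp add: algebra_simps)
    also have "\<dots> \<le> norm (v + of_nat p) * B1 + real (Suc p) * \<bar>B2\<bar>"
    proof (intro add_mono mult_left_mono)
      show "norm (zeta_diff n (1 + s) (v + of_nat p)) * c \<le> B1"
        using B1[OF s'] by (simp add: c_def)
      show "norm (zeta_diff (n - 1) (1 + s) (v + of_nat (Suc p))) * (real n * c) \<le> real (Suc p) * \<bar>B2\<bar>"
      proof (cases n)
        case (Suc q)
        \<comment> \<open>The loss of a factor \<open>n = Suc q\<close> at weight \<open>p\<close>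
          is exactly the weight \<open>Suc p\<close> at index \<open>q\<close>, up to the constant
          \<open>Suc p\<close>.\<close>
        have "Suc p * ((q + Suc p) choose Suc p) = Suc q * ((q + Suc p) choose p)"
          using binomial_absorb_comp[of "q + Suc p" p] binomial_absorption[of p "q + Suc p"]
          by (metis add_Suc_shift diff_add_inverse2)
        hence "real n * c = real (Suc p) * real ((q + Suc p) choose Suc p)"
          unfolding c_def Suc by (metis add_Suc_shift of_nat_mult)
        hence "norm (zeta_diff (n - 1) (1 + s) (v + of_nat (Suc p))) * (real n * c)
          = real (Suc p) * (norm (zeta_diff q (1 + s) (v + of_nat (Suc p))) * real ((q + Suc p) choose Suc p))"
          by (simp add: Suc)
        also have "\<dots> \<le> real (Suc p) * \<bar>B2\<bar>"
          by (intro mult_left_mono order.trans[OF B2[OF s']]) auto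
        finally show ?thesis .
      qed auto
    qed auto
    finally show ?thesis by (simp add: c_def)
  qed
  thus ?case by blast
qed

text \<open>A compact set lies in some half-plane \<open>Re s > - m\<close>, and for
  \<open>p = 0\<close> the binomial weight is 1.\<close>

lemma zeta_diff_bounded:
  assumes "Re v > 0" and "compact K"
  obtains B where "\<And>n s. s \<in> K \<Longrightarrow> norm (zeta_diff n s v) \<le> B"
proof -
  obtain C where C: "\<And>s. s \<in> K \<Longrightarrow> norm s \<le> C"
    using compact_imp_bounded[OF assms(2)] by (auto simp: bounded_iff)
  obtain m where m: "real m > C" using reals_Archimedean2 by blast
  have "K \<subseteq> {s. Re s > - real m}"
  proof safe
    fix s assume "s \<in> K"
    from C[OF this] m abs_Re_le_cmod[of s] show "Re s > - real m" by linarith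
  qed
  from zeta_diff_weighted_bound[OF assms this, of 0] that show ?thesis by auto
qed

lemma holomorphic_zeta_diff:
  assumes "Re v > 0"
  shows "(\<lambda>s. zeta_diff n s v) holomorphic_on A"
  unfolding zeta_diff_def by (intro holomorphic_intros)

text \<open>The differences are bounded on each closed unit disc, so the Weierstrass test applies
  there with majorant \<open>c n * B\<close>; locally uniform limits of entire functions are
  entire.\<close>

lemma
  fixes c :: "nat \<Rightarrow> real"
  assumes v: "Re v > 0" and c: "summable c" "\<And>n. c n \<ge> 0"
  shows summable_zeta_diff: "summable (\<lambda>n. of_real (c n) * zeta_diff n s v)"
    and holomorphic_suminf_zeta_diff: "(\<lambda>s. \<Sum>n. of_real (c n) * zeta_diff n s v) holomorphic_on A"
proof -
  have unif: "uniform_limit (cball x 1) (\<lambda>n s. \<Sum>i<n. of_real (c i) * zeta_diff i s v)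
      (\<lambda>s. \<Sum>n. of_real (c n) * zeta_diff n s v) sequentially" for x
  proof -
    obtain B where B: "\<And>n s. s \<in> cball x 1 \<Longrightarrow> norm (zeta_diff n s v) \<le> B"
      using zeta_diff_bounded[OF v compact_cball] by blast
    show ?thesis
    proof (rule Weierstrass_m_test)
      show "norm (of_real (c n) * zeta_diff n s v) \<le> c n * B" if "s \<in> cball x 1" for n s
        using B[OF that] c(2)[of n] by (auto simp: norm_mult intro!: mult_left_mono)
      show "summable (\<lambda>n. c n * B)" using c(1) by (rule summable_mult2)
    qed
  qed
  have "(\<lambda>s. \<Sum>n. of_real (c n) * zeta_diff n s v) holomorphic_on UNIV"
    by (rule holomorphic_uniform_sequence[of UNIV "\<lambda>n s. \<Sum>i<n. of_real (c i) * zeta_diff i s v"])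
       (auto intro!: holomorphic_intros holomorphic_zeta_diff v exI[of _ 1] unif)
  thus "(\<lambda>s. \<Sum>n. of_real (c n) * zeta_diff n s v) holomorphic_on A"
    by (rule holomorphic_on_subset) auto
  obtain B where B: "\<And>n. norm (zeta_diff n s v) \<le> B"
    using zeta_diff_bounded[OF v, of "{s}"] by auto
  show "summable (\<lambda>n. of_real (c n) * zeta_diff n s v)"
    by (rule summable_comparison_test'[OF summable_mult2[OF c(1), of B]])
       (use B c(2) in \<open>auto simp: norm_mult intro!: mult_left_mono\<close>)
qed

section \<open>Gregory coefficients\<close>

text \<open>Induction by the Stirling recurrence: multiplying by the next linear factor shifts the
  coefficients by one (\<open>pCons 0 P\<close>) and subtracts \<open>n\<close> times the old
  ones.\<close>

lemma signed_stirling1_sum: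
  fixes t :: real
  shows "(\<Prod>i<n. t - real i) = (\<Sum>l\<le>n. of_int (signed_stirling1 n l) * t ^ l)"
proof (induction n)
  case (Suc n)
  define P where "P = (\<Prod>i<n. [:- int i, 1:])"
  have deg: "coeff P (Suc n) = 0"
  proof (rule coeff_eq_0)
    have "degree P \<le> sum (degree \<circ> (\<lambda>i. [:- int i, 1:])) {..<n}"
      unfolding P_def by (rule degree_prod_sum_le) simp
    thus "degree P < Suc n" by simp
  qed
  have coeff: "signed_stirling1 (Suc n) l = - int n * coeff P l + coeff (pCons 0 P) l" for l
    unfolding signed_stirling1_def P_def[symmetric] prod.lessThan_Suc
    by (simp add: P_def mult.commute[of _ "[:- int n, 1:]"])
  have "(\<Sum>l\<le>Suc n. of_int (signed_stirling1 (Suc n) l) * t ^ l)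
     = - real n * (\<Sum>l\<le>Suc n. of_int (coeff P l) * t ^ l)
       + (\<Sum>l\<le>Suc n. of_int (coeff (pCons 0 P) l) * t ^ l)"
    unfolding sum_distrib_left sum.distrib[symmetric]
    by (intro sum.cong refl) (simp add: coeff ring_distribs)
  also have "(\<Sum>l\<le>Suc n. of_int (coeff P l) * t ^ l) = (\<Prod>i<n. t - real i)"
    using deg by (simp add: Suc.IH signed_stirling1_def flip: P_def)
  also have "(\<Sum>l\<le>Suc n. of_int (coeff (pCons 0 P) l) * t ^ l)
      = t * (\<Sum>l\<le>n. of_int (coeff P l) * t ^ l)"
    by (subst sum.atMost_Suc_shift) (simp add: sum_distrib_left mult_ac)
  also have "(\<Sum>l\<le>n. of_int (coeff P l) * t ^ l) = (\<Prod>i<n. t - real i)"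
    by (simp add: Suc.IH signed_stirling1_def P_def)
  finally show ?case by (simp add: algebra_simps)
qed (simp add: signed_stirling1_def)

text \<open>The falling factorial of positive length contains the factor \<open>t\<close>, so its
  constant coefficient vanishes and the sum may start at 1.\<close>

lemma gbinomial_eq_stirling_sum:
  fixes t :: real
  shows "(t gchoose Suc n) = (\<Sum>l=1..Suc n. of_int (signed_stirling1 (Suc n) l) * t ^ l) / fact (Suc n)"
proof -
  have "signed_stirling1 (Suc n) 0 = 0"
    by (auto simp: signed_stirling1_def poly_0_coeff_0[symmetric] poly_prod)
  hence "(\<Sum>l=1..Suc n. of_int (signed_stirling1 (Suc n) l) * t ^ l)
      = (\<Sum>l\<le>Suc n. of_int (signed_stirling1 (Suc n) l) * t ^ l)"
    by (intro sum.mono_neutral_left) (auto simp: not_le)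
  also have "\<dots> = (\<Prod>i<Suc n. t - real i)" by (rule signed_stirling1_sum[symmetric])
  finally show ?thesis
    by (simp only: gbinomial_prod_rev atLeast0LessThan)
qed

lemma power_pred_has_integral:
  assumes k: "k \<ge> 1"
  shows "((\<lambda>t. t ^ (k - 1)) has_integral 1 / real k) {0..1::real}"
proof -
  have "((\<lambda>t. t ^ (k - 1)) has_integral (1 ^ k / real k - 0 ^ k / real k)) {0..1::real}"
    by (rule fundamental_theorem_of_calculus)
       (use k in \<open>auto simp flip: has_real_derivative_iff_has_vector_derivative
          intro!: derivative_eq_intros\<close>)
  thus ?thesis using k by (simp add: power_0_left)
qed

text \<open>Termwise integration of the Stirling expansion: \<open>t ^ (k - 1) * t ^ l\<close> has
  integral \<open>1 / (l + k)\<close>, the denominator in the definition.\<close>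

lemma gregory_coeff_has_integral:
  assumes k: "k \<ge> 1"
  shows "((\<lambda>t. t ^ (k - 1) * (t gchoose Suc n)) has_integral gregory_coeff k (Suc n)) {0..1}"
proof -
  have "((\<lambda>t. \<Sum>l=1..Suc n. of_int (signed_stirling1 (Suc n) l) / fact (Suc n) * t ^ (l + k - 1))
      has_integral (\<Sum>l=1..Suc n. of_int (signed_stirling1 (Suc n) l) / fact (Suc n)
        * (1 / real (l + k)))) {0..1}"
    by (intro has_integral_sum has_integral_mult_right power_pred_has_integral) auto
  also have "(\<Sum>l=1..Suc n. of_int (signed_stirling1 (Suc n) l) / fact (Suc n)
        * (1 / real (l + k))) = gregory_coeff k (Suc n)"
    unfolding gregory_coeff_def sum_distrib_left
    by (intro sum.cong refl) simp
  finally show ?thesis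
  proof (rule has_integral_eq[rotated])
    fix t :: real
    have "t ^ (l + k - 1) = t ^ (k - 1) * t ^ l" for l
      using k by (simp add: power_add[symmetric] add.commute)
    thus "(\<Sum>l=1..Suc n. of_int (signed_stirling1 (Suc n) l) / fact (Suc n) * t ^ (l + k - 1))
        = t ^ (k - 1) * (t gchoose Suc n)"
      unfolding gbinomial_eq_stirling_sum sum_divide_distrib sum_distrib_left
      by (intro sum.cong refl) simp
  qed
qed

section \<open>Signs, summability and generating function of the coefficients\<close>

text \<open>The sign turns the binomial coefficient into a Pochhammer symbol at \<open>- t\<close>,
  a product of nonnegative factors.\<close>

lemma gbinomial_alternating_nonneg:
  fixes t :: real
  assumes "t \<le> 0"
  shows "(-1) ^ n * (t gchoose n) \<ge> 0"
proof -
  have "(-1) ^ n * (t gchoose n) = ((-1) ^ n * (-1) ^ n) * (pochhammer (- t) n / fact n)"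
    by (simp add: gbinomial_pochhammer)
  also have "\<dots> \<ge> 0"
    using assms by (auto simp: pochhammer_prod power_mult_distrib[symmetric] intro!: divide_nonneg_nonneg prod_nonneg)
  finally show ?thesis .
qed

text \<open>Absorption extracts the factor \<open>t / Suc n\<close> and leaves the upper index
  \<open>t - 1\<close>, which is nonpositive.\<close>

lemma gbinomial_shifted_alternating_nonneg:
  fixes t :: real
  assumes "0 \<le> t" "t \<le> 1"
  shows "(-1) ^ n * (t gchoose Suc n) \<ge> 0"
proof -
  have "(-1) ^ n * (t gchoose Suc n) = t / real (Suc n) * ((-1) ^ n * (t - 1 gchoose n))"
    using gbinomial_absorption'[of "Suc n" t] by simp
  also have "\<dots> \<ge> 0"
    using assms by (intro mult_nonneg_nonneg gbinomial_alternating_nonneg) auto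
  finally show ?thesis .
qed

text \<open>With the term 1 at index 0 included, the alternating sum telescopes to
  \<open>(-1) ^ N * (t - 1 gchoose N)\<close>, which is nonnegative.\<close>

lemma gbinomial_shifted_alternating_sum_le_1:
  fixes t :: real
  assumes "0 \<le> t" "t \<le> 1"
  shows "(\<Sum>n<N. (-1) ^ n * (t gchoose Suc n)) \<le> 1"
proof -
  have "(\<Sum>n\<le>N. (t gchoose n) * (-1) ^ n) = 1 - (\<Sum>n<N. (-1) ^ n * (t gchoose Suc n))"
    by (subst sum.atMost_shift) (simp add: sum_negf[symmetric] mult_ac)
  moreover have "(\<Sum>n\<le>N. (t gchoose n) * (-1) ^ n) \<ge> 0"
    using gbinomial_alternating_nonneg[of "t - 1" N] assms by (simp add: gbinomial_sum_lower_neg)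
  ultimately show ?thesis by linarith
qed

text \<open>For \<open>k \<ge> 1\<close> this is the absolute value of the coefficient, since the
  signs alternate; it carries the sign and index shift of the series in the theorem.\<close>

definition gregory_abs :: "nat \<Rightarrow> nat \<Rightarrow> real" where
  "gregory_abs k n = (-1) ^ n * gregory_coeff k (n + 1)"

lemma gregory_abs_has_integral:
  assumes k: "k \<ge> 1"
  shows "((\<lambda>t. t ^ (k - 1) * ((-1) ^ n * (t gchoose Suc n))) has_integral gregory_abs k n) {0..1}"
  using has_integral_mult_right[OF gregory_coeff_has_integral[OF k, of n], of "(-1) ^ n"]
  by (simp add: gregory_abs_def mult_ac)

lemma gregory_abs_nonneg: "k \<ge> 1 \<Longrightarrow> gregory_abs k n \<ge> 0"
  by (rule has_integral_nonneg[OF gregory_abs_has_integral])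
     (auto intro!: mult_nonneg_nonneg gbinomial_shifted_alternating_nonneg)

lemma sum_gregory_abs_le:
  assumes k: "k \<ge> 1"
  shows "(\<Sum>n<N. gregory_abs k n) \<le> 1 / real k"
proof (rule has_integral_le)
  show "((\<lambda>t. \<Sum>n<N. t ^ (k - 1) * ((-1) ^ n * (t gchoose Suc n))) has_integral
      (\<Sum>n<N. gregory_abs k n)) {0..1}"
    by (intro has_integral_sum gregory_abs_has_integral k) auto
  fix t :: real assume "t \<in> {0..1}"
  thus "(\<Sum>n<N. t ^ (k - 1) * ((-1) ^ n * (t gchoose Suc n))) \<le> t ^ (k - 1)"
    using mult_left_mono[OF gbinomial_shifted_alternating_sum_le_1[of t N], of "t ^ (k - 1)"]
    by (simp add: sum_distrib_left)
qed (rule power_pred_has_integral[OF k])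

lemma summable_gregory_abs:
  assumes "k \<ge> 1"
  shows "summable (gregory_abs k)"
  using gregory_abs_nonneg[OF assms] sum_gregory_abs_le[OF assms]
  by (intro summableI_nonneg_bounded)

text \<open>Termwise integration of the binomial series of \<open>1 - (1 - x) powr t\<close> against
  \<open>t ^ (k - 1)\<close>.\<close>

lemma gregory_abs_sums:
  assumes k: "k \<ge> 1" and x: "0 < x" "x < 1"
  shows "(\<lambda>n. gregory_abs k n * x ^ Suc n) sums
    (1 / real k - integral {0..1} (\<lambda>t. t ^ (k - 1) * (1 - x) powr t))"
proof -
  define f where "f = (\<lambda>n t. t ^ (k - 1) * ((-1) ^ n * (t gchoose Suc n)) * x ^ Suc n)"
  define g where "g = (\<lambda>t. t ^ (k - 1) * (1 - (1 - x) powr t))"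
  have int: "(f n has_integral (gregory_abs k n * x ^ Suc n)) {0..1}" for n
    unfolding f_def by (intro has_integral_mult_left gregory_abs_has_integral k)
  have bound: "norm (\<Sum>i<n. f i t) \<le> t ^ (k - 1)" if t: "t \<in> {0..1}" for n t
  proof -
    have b: "(-1) ^ i * (t gchoose Suc i) \<ge> 0" for i
      using t gbinomial_shifted_alternating_nonneg[of t i] by auto
    \<comment> \<open>The powers of \<open>x\<close> are at most 1 and their coefficients are
      nonnegative, so the uniform bound at \<open>x = 1\<close> suffices.\<close>
    have "(\<Sum>i<n. (-1) ^ i * (t gchoose Suc i) * x ^ Suc i) \<le> (\<Sum>i<n. (-1) ^ i * (t gchoose Suc i) * 1)"
      using x by (intro sum_mono mult_left_mono b power_le_one) auto
    also have "\<dots> \<le> 1"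
      using gbinomial_shifted_alternating_sum_le_1[of t n] t by simp
    finally have le: "(\<Sum>i<n. (-1) ^ i * (t gchoose Suc i) * x ^ Suc i) \<le> 1" .
    have nn: "0 \<le> (\<Sum>i<n. (-1) ^ i * (t gchoose Suc i) * x ^ Suc i)"
      using x by (intro sum_nonneg mult_nonneg_nonneg b) auto
    have eq: "(\<Sum>i<n. f i t) = t ^ (k - 1) * (\<Sum>i<n. (-1) ^ i * (t gchoose Suc i) * x ^ Suc i)"
      by (simp add: f_def sum_distrib_left mult_ac)
    show ?thesis
      unfolding eq using t nn mult_left_mono[OF le, of "t ^ (k - 1)"] by (simp add: abs_mult)
  qed
  have sums: "(\<lambda>n. f n t) sums g t" for t
  proof -
    have "(\<lambda>n. (t gchoose n) * (- x) ^ n) sums ((1 - x) powr t)"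
      using gen_binomial_real[of "- x" t] x by simp
    hence "(\<lambda>n. (t gchoose Suc n) * (- x) ^ Suc n) sums ((1 - x) powr t - 1)"
      by (subst sums_Suc_iff) simp
    hence "(\<lambda>n. - (t ^ (k - 1)) * ((t gchoose Suc n) * (- x) ^ Suc n))
        sums (- (t ^ (k - 1)) * ((1 - x) powr t - 1))"
      by (rule sums_mult)
    moreover have "- (t ^ (k - 1)) * ((t gchoose Suc n) * (- x) ^ Suc n) = f n t" for n
      by (subst power_minus[of x]) (simp add: f_def mult_ac)
    moreover have "- (t ^ (k - 1)) * ((1 - x) powr t - 1) = g t"
      by (simp add: g_def algebra_simps)
    ultimately show ?thesis by simp
  qed
  note pw = power_pred_has_integral[OF k]
  note main = has_integral_sums_dominated[OF int has_integral_integrable[OF pw] bound sums]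
  have eq: "t ^ (k - 1) * (1 - x) powr t = t ^ (k - 1) - g t" for t
    by (simp add: g_def algebra_simps)
  have "((\<lambda>t. t ^ (k - 1) - g t) has_integral (1 / real k - integral {0..1} g)) {0..1}"
    by (intro has_integral_diff pw integrable_integral main(1))
  thus ?thesis
    using main(2) unfolding eq by (simp add: integral_unique)
qed

section \<open>Exponential moments on the unit interval\<close>

text \<open>For \<open>k \<ge> 1\<close> and \<open>u > 0\<close>, the closed form of
  \<open>k\<close> times the integral of \<open>t ^ (k - 1) * exp (- (t * u))\<close> over the unit
  interval. Its separate powers of \<open>u\<close> are what the Mellin transform turns into zeta
  values.\<close>

definition exp_moment :: "nat \<Rightarrow> real \<Rightarrow> real" where
  "exp_moment k u = fact k / u ^ k - (\<Sum>l=1..k. fact k / fact (k - l) / u ^ l) * exp (- u)"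

text \<open>The algebraic counterpart of one integration by parts.\<close>

lemma exp_moment_Suc:
  assumes "u > 0"
  shows "exp_moment (Suc k) u = real (Suc k) / u * (exp_moment k u - exp (- u))"
proof -
  have "(\<Sum>l=1..Suc k. fact (Suc k) / fact (Suc k - l) / u ^ l)
      = (\<Sum>l=0..k. fact (Suc k) / fact (k - l) / u ^ Suc l)"
    using sum.shift_bounds_cl_Suc_ivl[of "\<lambda>l. fact (Suc k) / fact (Suc k - l) / u ^ l" 0 k] by simp
  also have "\<dots> = real (Suc k) / u * (\<Sum>l=0..k. fact k / fact (k - l) / u ^ l)"
    unfolding sum_distrib_left by (intro sum.cong refl) simp
  also have "(\<Sum>l=0..k. fact k / fact (k - l) / u ^ l) = 1 + (\<Sum>l=1..k. fact k / fact (k - l) / u ^ l)"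
    by (subst sum.atLeast_Suc_atMost) auto
  finally have "(\<Sum>l=1..Suc k. fact (Suc k) / fact (Suc k - l) / u ^ l)
    = real (Suc k) / u * (1 + (\<Sum>l=1..k. fact k / fact (k - l) / u ^ l))" .
  moreover have "fact (Suc k) / u ^ Suc k = real (Suc k) / u * (fact k / u ^ k)" by simp
  ultimately show ?thesis
    unfolding exp_moment_def by (simp only: ring_distribs mult_1 mult_1_right mult.assoc diff_diff_eq)
qed

lemma exp_moment_has_integral:
  assumes u: "u > 0"
  shows "((\<lambda>t. real (Suc k) * t ^ k * exp (- (t * u))) has_integral exp_moment (Suc k) u) {0..1}"
proof (induction k)
  case 0
  have "((\<lambda>t. exp (- (t * u))) has_integral (- exp (- (1 * u)) / u - - exp (- (0 * u)) / u)) {0..1}"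
    by (rule fundamental_theorem_of_calculus)
       (use u in \<open>auto simp flip: has_real_derivative_iff_has_vector_derivative
          intro!: derivative_eq_intros\<close>)
  thus ?case by (simp add: exp_moment_def diff_divide_distrib)
next
  case (Suc k)
  have ftc: "((\<lambda>t. real (Suc k) * t ^ k * exp (- (t * u)) - u * (t ^ Suc k * exp (- (t * u)))) has_integral
      (1 ^ Suc k * exp (- (1 * u)) - 0 ^ Suc k * exp (- (0 * u)))) {0..1}"
    by (rule fundamental_theorem_of_calculus)
       (auto simp del: power_Suc simp flip: has_real_derivative_iff_has_vector_derivative
          intro!: derivative_eq_intros)
  \<comment> \<open>Subtracting the derivative of \<open>t ^ Suc k * exp (- (t * u))\<close>,
    integrated in \<open>ftc\<close>, from the previous integrand isolates the next power of
    \<open>t\<close>.\<close>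
  have "((\<lambda>t. real (Suc (Suc k)) / u * (real (Suc k) * t ^ k * exp (- (t * u))
        - (real (Suc k) * t ^ k * exp (- (t * u)) - u * (t ^ Suc k * exp (- (t * u)))))) has_integral
      (real (Suc (Suc k)) / u * (exp_moment (Suc k) u -
        (1 ^ Suc k * exp (- (1 * u)) - 0 ^ Suc k * exp (- (0 * u)))))) {0..1}"
    by (intro has_integral_mult_right has_integral_diff Suc ftc)
  also have "real (Suc (Suc k)) / u * (exp_moment (Suc k) u -
        (1 ^ Suc k * exp (- (1 * u)) - 0 ^ Suc k * exp (- (0 * u)))) = exp_moment (Suc (Suc k)) u"
    by (simp add: exp_moment_Suc[OF u, of "Suc k"])
  finally show ?case
    by (rule has_integral_eq[rotated]) (use u in simp)
qed

text \<open>The choice \<open>x = 1 - exp (- u)\<close> turns \<open>(1 - x) powr t\<close> into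
  \<open>exp (- (t * u))\<close>; multiplication by \<open>k / x\<close> removes one power of
  \<open>x\<close>.\<close>

lemma gregory_abs_exp_sums:
  assumes k: "k \<ge> 1" and u: "u > 0"
  shows "(\<lambda>n. real k * gregory_abs k n * (1 - exp (- u)) ^ n) sums
    ((1 - exp_moment k u) / (1 - exp (- u)))"
proof -
  define x where "x = 1 - exp (- u)"
  have x: "0 < x" "x < 1" using u by (auto simp: x_def)
  note sums = gregory_abs_sums[OF k x]
  obtain m where m: "k = Suc m" using k by (cases k) auto
  have "real k * integral {0..1} (\<lambda>t. t ^ (k - 1) * (1 - x) powr t)
     = integral {0..1} (\<lambda>t. real k * (t ^ (k - 1) * (1 - x) powr t))"
    by (rule integral_mult_right[symmetric])
  also have "(\<lambda>t. real k * (t ^ (k - 1) * (1 - x) powr t)) = (\<lambda>t. real (Suc m) * t ^ m * exp (- (t * u)))"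
    by (simp add: m x_def powr_def mult_ac fun_eq_iff)
  also have "integral {0..1} \<dots> = exp_moment k u"
    unfolding m by (rule integral_unique[OF exp_moment_has_integral[OF u]])
  finally have "real k * integral {0..1} (\<lambda>t. t ^ (k - 1) * (1 - x) powr t) = exp_moment k u" .
  hence sum: "real k / x * (1 / real k - integral {0..1} (\<lambda>t. t ^ (k - 1) * (1 - x) powr t))
      = (1 - exp_moment k u) / x"
    using k x by (simp add: field_simps)
  have summand: "real k / x * (gregory_abs k n * x ^ Suc n) = real k * gregory_abs k n * x ^ n" for n
    using x by simp
  show ?thesis
    using sums_mult[OF sums, of "real k / x"] unfolding x_def[symmetric] sum summand .
qed

text \<open>Both estimates come from the series for the quotient: its terms are nonnegative, and its
  partial sums are at most \<open>k\<close> times those of \<open>gregory_abs k\<close>, hence at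
  most 1.\<close>

lemma exp_moment_bounds:
  assumes k: "k \<ge> 1" and u: "u > 0"
  shows "exp_moment k u \<le> 1" "1 - exp_moment k u \<le> 1 - exp (- u)"
proof -
  have x: "0 < 1 - exp (- u)" "1 - exp (- u) < 1" using u by auto
  have nn: "0 \<le> real k * gregory_abs k n * (1 - exp (- u)) ^ n" for n
    using gregory_abs_nonneg[OF k] x by simp
  have "0 \<le> (1 - exp_moment k u) / (1 - exp (- u))"
    by (rule sums_le[OF _ sums_zero gregory_abs_exp_sums[OF k u]]) (use nn in auto)
  thus "exp_moment k u \<le> 1" using x by (simp add: zero_le_divide_iff)
  have "(\<Sum>n<N. real k * gregory_abs k n * (1 - exp (- u)) ^ n) \<le> 1" for N
  proof -
    have "(\<Sum>n<N. real k * gregory_abs k n * (1 - exp (- u)) ^ n) \<le> (\<Sum>n<N. real k * gregory_abs k n * 1)"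
      using x gregory_abs_nonneg[OF k] by (intro sum_mono mult_left_mono power_le_one) auto
    also have "\<dots> = real k * (\<Sum>n<N. gregory_abs k n)" by (simp add: sum_distrib_left)
    also have "\<dots> \<le> 1" using sum_gregory_abs_le[OF k, of N] k by (simp add: field_simps)
    finally show ?thesis .
  qed
  hence "(1 - exp_moment k u) / (1 - exp (- u)) \<le> 1"
    using gregory_abs_exp_sums[OF k u] unfolding sums_def by (intro LIMSEQ_le_const2) auto
  thus "1 - exp_moment k u \<le> 1 - exp (- u)" using x by (simp add: divide_le_eq)
qed

section \<open>The identity on a half-plane\<close>

text \<open>The coefficient in the theorem; for \<open>l \<le> k\<close> and \<open>Re s > l\<close>
  it is \<open>fact k / fact (k - l) * Gamma (s - l) / Gamma s\<close>.\<close>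

definition zeta_coeff :: "nat \<Rightarrow> nat \<Rightarrow> complex \<Rightarrow> complex" where
  "zeta_coeff k l s = pochhammer (of_nat k - of_nat l + 1) l / pochhammer (s - of_nat l) l"

text \<open>For \<open>Re s > k\<close> and \<open>Re v > 0\<close>, the Mellin transform at
  \<open>s\<close> of \<open>exp (- (v * u)) * (1 - exp_moment k u)\<close>, divided by
  \<open>Gamma s\<close>.\<close>

definition zeta_summand :: "nat \<Rightarrow> complex \<Rightarrow> complex \<Rightarrow> complex" where
  "zeta_summand k s v = v powr (- s) - zeta_coeff k k s * v powr (of_nat k - s)
     + (\<Sum>l=1..k. zeta_coeff k l s * (v + 1) powr (of_nat l - s))"

lemma zeta_coeff_times_Gamma:
  assumes l: "l \<le> k" and s: "Re s > real l"
  shows "zeta_coeff k l s * Gamma s = fact k / fact (k - l) * Gamma (s - of_nat l)"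
proof -
  have "s - of_nat l \<notin> \<int>\<^sub>\<le>\<^sub>0"
  proof
    assume "s - of_nat l \<in> \<int>\<^sub>\<le>\<^sub>0"
    then obtain n where "s - of_nat l = - of_nat n" by (auto elim!: nonpos_Ints_cases')
    hence "Re (s - of_nat l) = - real n" by simp
    thus False using s by simp
  qed
  hence "pochhammer (s - of_nat l) l = Gamma s / Gamma (s - of_nat l)" "Gamma (s - of_nat l) \<noteq> 0"
    using pochhammer_Gamma[of "s - of_nat l" l] by (auto simp: Gamma_eq_zero_iff)
  moreover have "Gamma s \<noteq> 0"
    using s by (auto simp: Gamma_eq_zero_iff elim!: nonpos_Ints_cases')
  moreover have "pochhammer (of_nat k - of_nat l + 1 :: complex) l = fact k / fact (k - l)"
    using pochhammer_product'[of "1::complex" "k - l" l] l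
    by (simp add: pochhammer_fact[symmetric] of_nat_diff add_ac field_simps)
  ultimately show ?thesis by (simp add: zeta_coeff_def)
qed

text \<open>In the expanded \<open>exp_moment\<close>, division by \<open>u ^ l\<close> lowers
  \<open>s\<close> by \<open>l\<close>, whence the condition \<open>Re s > k\<close>, and the factor
  \<open>exp (- u)\<close> moves \<open>v\<close> to \<open>v + 1\<close>.\<close>

lemma zeta_summand_has_integral:
  assumes s: "Re s > real k" and v: "Re v > 0"
  shows "((\<lambda>u. of_real u powr (s - 1) * exp (- (v * of_real u)) * of_real (1 - exp_moment k u))
           has_integral (Gamma s * zeta_summand k s v)) {0<..}"
proof -
  have "((\<lambda>u. of_real u powr (s - 1) * exp (- (v * of_real u))
       - fact k / fact (k - k) * (of_real u powr (s - of_nat k - 1) * exp (- (v * of_real u)))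
       + (\<Sum>l=1..k. fact k / fact (k - l) * (of_real u powr (s - of_nat l - 1) * exp (- ((v + 1) * of_real u)))))
      has_integral (Gamma s * v powr (- s)
       - fact k / fact (k - k) * (Gamma (s - of_nat k) * v powr (- (s - of_nat k)))
       + (\<Sum>l=1..k. fact k / fact (k - l) * (Gamma (s - of_nat l) * (v + 1) powr (- (s - of_nat l)))))) {0<..}"
    using s v by (intro has_integral_add has_integral_diff has_integral_sum has_integral_mult_right
        Gamma_integral_scaled) auto
  also have "Gamma s * v powr (- s)
       - fact k / fact (k - k) * (Gamma (s - of_nat k) * v powr (- (s - of_nat k)))
       + (\<Sum>l=1..k. fact k / fact (k - l) * (Gamma (s - of_nat l) * (v + 1) powr (- (s - of_nat l))))
     = Gamma s * zeta_summand k s v"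
  proof -
    have *: "fact k / fact (k - l) * (Gamma (s - of_nat l) * z powr (- (s - of_nat l)))
      = Gamma s * (zeta_coeff k l s * z powr (of_nat l - s))" if "l \<le> k" for l z
      using arg_cong[OF zeta_coeff_times_Gamma[OF that, of s], of "\<lambda>x. x * z powr (of_nat l - s)"] s that
      by (simp add: mult_ac)
    have "(\<Sum>l=1..k. fact k / fact (k - l) * (Gamma (s - of_nat l) * (v + 1) powr (- (s - of_nat l))))
      = Gamma s * (\<Sum>l=1..k. zeta_coeff k l s * (v + 1) powr (of_nat l - s))"
      unfolding sum_distrib_left by (intro sum.cong refl *) auto
    thus ?thesis
      unfolding zeta_summand_def *[OF order.refl] by (simp only: ring_distribs)
  qed
  finally show ?thesis
  proof (rule has_integral_eq[rotated])
    fix u :: real assume u: "u \<in> {0<..}"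
    have pw: "complex_of_real u powr (s - of_nat l - 1) = of_real u powr (s - 1) / of_real u ^ l" for l
      using u powr_diff[of "complex_of_real u" "s - 1" "of_nat l"]
      by (simp add: powr_nat' algebra_simps)
    have ex: "exp (- ((v + 1) * of_real u)) = exp (- (v * of_real u)) * exp (- complex_of_real u)"
      by (simp add: ring_distribs flip: exp_add)
    have em: "complex_of_real (1 - exp_moment k u) = 1 - fact k / of_real u ^ k
       + (\<Sum>l=1..k. fact k / fact (k - l) / of_real u ^ l) * exp (- of_real u)"
      by (simp add: exp_moment_def exp_of_real[symmetric])
    show "of_real u powr (s - 1) * exp (- (v * of_real u))
       - fact k / fact (k - k) * (of_real u powr (s - of_nat k - 1) * exp (- (v * of_real u)))
       + (\<Sum>l=1..k. fact k / fact (k - l) * (of_real u powr (s - of_nat l - 1) * exp (- ((v + 1) * of_real u))))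
      = of_real u powr (s - 1) * exp (- (v * of_real u)) * of_real (1 - exp_moment k u)"
      unfolding pw ex em by (simp add: ring_distribs sum_distrib_left sum_distrib_right mult_ac)
  qed
qed

text \<open>Both series are termwise integrals of expansions of the same integrand,
  \<open>u powr (s - 1) * exp (- v u) * (1 - exp_moment k u) / (1 - exp (- u))\<close>: one in powers of
  \<open>1 - exp (- u)\<close>, the other (the geometric series) in powers of \<open>exp (- u)\<close>.\<close>
lemma zeta_summand_sums:
  assumes k: "k \<ge> 1" and s: "Re s > real k" and v: "Re v > 0"
  shows "(\<lambda>m. zeta_summand k s (of_nat m + v)) sums
    (of_nat k * (\<Sum>n. of_real (gregory_abs k n) * zeta_diff n s v))"
proof -
  have s0: "Re s > 0" using s by linarith
  define W where "W = (\<lambda>u. of_real u powr (s - 1) * exp (- (v * complex_of_real u)))"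
  define h where "h = (\<lambda>u. u powr (Re s - 1) * exp (- (Re v * u)))"
  define g where "g = (\<lambda>u. W u * of_real ((1 - exp_moment k u) / (1 - exp (- u))))"
  have h: "h integrable_on {0<..}"
    unfolding h_def using Gamma_integral_scaled_real[OF s0 v] by blast
  have W: "norm (W u) = h u" if "u > 0" for u
    unfolding W_def h_def by (rule norm_powr_times_exp[OF that])
  \<comment> \<open>Both expansions have nonnegative weights with total
    \<open>(1 - exp_moment k u) / (1 - exp (- u))\<close>, which is at most 1, so one majorant
    serves both.\<close>
  have dominated: "norm (\<Sum>i<n. W u * of_real (c i)) \<le> h u"
    if "u > 0" "\<And>i. c i \<ge> 0" "(\<Sum>i<n. c i) \<le> 1" for u c and n :: nat
  proof -
    have "norm (\<Sum>i<n. W u * of_real (c i)) = h u * (\<Sum>i<n. c i)"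
      using that by (simp add: W[symmetric] sum_nonneg norm_mult flip: sum_distrib_left of_real_sum)
    also have "\<dots> \<le> h u * 1" using that by (intro mult_left_mono) (auto simp: h_def)
    finally show ?thesis by simp
  qed

  have A: "(\<lambda>n. of_nat k * of_real (gregory_abs k n) * (Gamma s * zeta_diff n s v)) sums integral {0<..} g"
  proof (rule has_integral_sums_dominated)
    show "((\<lambda>u. W u * of_real (real k * gregory_abs k n * (1 - exp (- u)) ^ n)) has_integral
        of_nat k * of_real (gregory_abs k n) * (Gamma s * zeta_diff n s v)) {0<..}" for n
      using has_integral_mult_right[OF has_integral_zeta_diff[OF s0 v, of n],
          of "of_nat k * of_real (gregory_abs k n)"]
      by (simp add: W_def mult_ac)
    show "h integrable_on {0<..}" by (rule h)
    fix u :: real assume "u \<in> {0<..}"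
    hence u: "u > 0" by simp
    show "(\<lambda>n. W u * of_real (real k * gregory_abs k n * (1 - exp (- u)) ^ n)) sums g u"
      unfolding g_def by (intro sums_mult sums_of_real gregory_abs_exp_sums k u)
    fix n
    show "norm (\<Sum>i<n. W u * of_real (real k * gregory_abs k i * (1 - exp (- u)) ^ i)) \<le> h u"
    proof (rule dominated[OF u])
      show nn: "0 \<le> real k * gregory_abs k i * (1 - exp (- u)) ^ i" for i
        using gregory_abs_nonneg[OF k] u by simp
      have "(\<Sum>i<n. real k * gregory_abs k i * (1 - exp (- u)) ^ i)
          \<le> (\<Sum>i. real k * gregory_abs k i * (1 - exp (- u)) ^ i)"
        using gregory_abs_exp_sums[OF k u] nn by (intro sum_le_suminf) (auto simp: sums_iff)
      also have "\<dots> = (1 - exp_moment k u) / (1 - exp (- u))"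
        using gregory_abs_exp_sums[OF k u] by (simp add: sums_iff)
      also have "\<dots> \<le> 1" using exp_moment_bounds[OF k u] u by simp
      finally show "(\<Sum>i<n. real k * gregory_abs k i * (1 - exp (- u)) ^ i) \<le> 1" .
    qed
  qed

  have B: "(\<lambda>m. Gamma s * zeta_summand k s (of_nat m + v)) sums integral {0<..} g"
  proof (rule has_integral_sums_dominated)
    show "((\<lambda>u. W u * of_real ((1 - exp_moment k u) * exp (- u) ^ m)) has_integral
        Gamma s * zeta_summand k s (of_nat m + v)) {0<..}" for m
    proof (rule has_integral_eq)
      show "((\<lambda>u. of_real u powr (s - 1) * exp (- ((of_nat m + v) * of_real u)) * of_real (1 - exp_moment k u))
        has_integral Gamma s * zeta_summand k s (of_nat m + v)) {0<..}"
        using v by (intro zeta_summand_has_integral s) (auto intro: add_nonneg_pos)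
      fix u :: real
      have "exp (- ((of_nat m + v) * of_real u)) = exp (- (v * of_real u)) * complex_of_real (exp (- u) ^ m)"
        by (simp add: exp_of_real[symmetric] exp_of_nat_mult[symmetric] ring_distribs add_ac flip: exp_add)
      thus "of_real u powr (s - 1) * exp (- ((of_nat m + v) * of_real u)) * of_real (1 - exp_moment k u)
        = W u * of_real ((1 - exp_moment k u) * exp (- u) ^ m)"
        by (simp add: W_def mult_ac)
    qed
    show "h integrable_on {0<..}" by (rule h)
    fix u :: real assume "u \<in> {0<..}"
    hence u: "u > 0" by simp
    have geo: "(\<lambda>m. (1 - exp_moment k u) * exp (- u) ^ m) sums ((1 - exp_moment k u) / (1 - exp (- u)))"
      using sums_mult[OF geometric_sums[of "exp (- u)"], of "1 - exp_moment k u"] u by simp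
    thus "(\<lambda>m. W u * of_real ((1 - exp_moment k u) * exp (- u) ^ m)) sums g u"
      unfolding g_def by (intro sums_mult sums_of_real)
    fix n
    show "norm (\<Sum>m<n. W u * of_real ((1 - exp_moment k u) * exp (- u) ^ m)) \<le> h u"
    proof (rule dominated[OF u])
      show nn: "0 \<le> (1 - exp_moment k u) * exp (- u) ^ m" for m
        using exp_moment_bounds[OF k u] by simp
      have "(\<Sum>m<n. (1 - exp_moment k u) * exp (- u) ^ m) \<le> (\<Sum>m. (1 - exp_moment k u) * exp (- u) ^ m)"
        using geo nn by (intro sum_le_suminf) (auto simp: sums_iff)
      also have "\<dots> = (1 - exp_moment k u) / (1 - exp (- u))"
        using geo by (simp add: sums_iff)
      also have "\<dots> \<le> 1" using exp_moment_bounds[OF k u] u by simp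
      finally show "(\<Sum>m<n. (1 - exp_moment k u) * exp (- u) ^ m) \<le> 1" .
    qed
  qed

  have G: "Gamma s \<noteq> 0"
    using s0 by (auto simp: Gamma_eq_zero_iff elim!: nonpos_Ints_cases)
  \<comment> \<open>Summability is known independently of the integral, so \<open>Gamma s\<close>
    can be taken out of the series and cancelled.\<close>
  have "summable (\<lambda>n. of_real (gregory_abs k n) * zeta_diff n s v)"
    by (rule summable_zeta_diff[OF v summable_gregory_abs[OF k] gregory_abs_nonneg[OF k]])
  hence "(\<lambda>n. of_nat k * Gamma s * (of_real (gregory_abs k n) * zeta_diff n s v)) sums
      (of_nat k * Gamma s * (\<Sum>n. of_real (gregory_abs k n) * zeta_diff n s v))"
    by (intro sums_mult summable_sums)
  hence "(\<lambda>n. of_nat k * of_real (gregory_abs k n) * (Gamma s * zeta_diff n s v)) sums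
      (of_nat k * Gamma s * (\<Sum>n. of_real (gregory_abs k n) * zeta_diff n s v))"
    by (simp add: mult_ac)
  from sums_unique2[OF A this]
  have "integral {0<..} g = Gamma s * (of_nat k * (\<Sum>n. of_real (gregory_abs k n) * zeta_diff n s v))"
    by (simp add: mult_ac)
  with B G show ?thesis by (simp add: sums_mult_iff)
qed

section \<open>Analytic continuation\<close>

text \<open>The argument is at most \<open>pi\<close> in absolute value, so the imaginary part of
  \<open>z\<close> costs only a constant factor, while the negative real part forces decay.\<close>

lemma shifted_powr_tendsto_0:
  assumes v: "Re v > 0" and z: "Re z < 0"
  shows "(\<lambda>m. (of_nat m + v) powr z) \<longlonglongrightarrow> 0"
proof (rule Lim_null_comparison)
  have re: "Re (of_nat m + v) > 0" for m using v by (simp add: add_nonneg_pos)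
  show "\<forall>\<^sub>F m in sequentially. norm ((of_nat m + v) powr z)
      \<le> exp (\<bar>Im z\<bar> * pi) * norm (of_nat m + v) powr Re z"
  proof (intro always_eventually allI)
    fix m
    have nz: "of_nat m + v \<noteq> 0" using re[of m] by force
    have "\<bar>Im (Ln (of_nat m + v))\<bar> \<le> pi"
      using Im_Ln_le_pi[OF nz] mpi_less_Im_Ln[OF nz] by linarith
    hence "\<bar>Im z * Im (Ln (of_nat m + v))\<bar> \<le> \<bar>Im z\<bar> * pi"
      unfolding abs_mult by (intro mult_left_mono) auto
    hence "norm ((of_nat m + v) powr z) \<le> exp (\<bar>Im z\<bar> * pi + Re z * ln (norm (of_nat m + v)))"
      using nz by (simp add: powr_def)
    thus "norm ((of_nat m + v) powr z) \<le> exp (\<bar>Im z\<bar> * pi) * norm (of_nat m + v) powr Re z"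
      using nz by (simp add: exp_add powr_def)
  qed
  have "filterlim (\<lambda>m. norm (of_nat m + v)) at_top sequentially"
  proof (rule filterlim_at_top_mono[OF filterlim_real_sequentially always_eventually], rule allI)
    fix m
    show "real m \<le> norm (of_nat m + v)"
      using complex_Re_le_cmod[of "of_nat m + v"] v by simp
  qed
  hence "(\<lambda>m. norm (of_nat m + v) powr Re z) \<longlonglongrightarrow> 0"
    by (rule tendsto_neg_powr[OF z])
  thus "(\<lambda>m. exp (\<bar>Im z\<bar> * pi) * norm (of_nat m + v) powr Re z) \<longlonglongrightarrow> 0"
    by (rule tendsto_mult_right_zero)
qed

text \<open>The right side of the identity for \<open>k = 1\<close>, taken as an explicit
  continuation of the Hurwitz zeta-function with its polar term split off.\<close>

definition gregory_zeta :: "complex \<Rightarrow> complex \<Rightarrow> complex" where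
  "gregory_zeta v s = v powr (1 - s) / (s - 1) + (\<Sum>n. of_real (gregory_abs 1 n) * zeta_diff n s v)"

text \<open>For \<open>k = 1\<close> the summand is \<open>(m + v) powr (- s)\<close> plus a
  difference of consecutive values of \<open>p\<close>, divided by \<open>s - 1\<close>. The
  differences telescope and leave the polar term.\<close>

lemma gregory_zeta_sums:
  assumes v: "Re v > 0" and s: "Re s > 1"
  shows "(\<lambda>m. (of_nat m + v) powr (- s)) sums gregory_zeta v s"
proof -
  define p where "p = (\<lambda>m. (of_nat m + v) powr (1 - s))"
  have "p \<longlonglongrightarrow> 0" unfolding p_def by (rule shifted_powr_tendsto_0) (use v s in auto)
  hence "(\<lambda>m. p (Suc m) - p m) sums (0 - p 0)" by (rule telescope_sums)
  from sums_diff[OF zeta_summand_sums[of 1 s v] sums_divide[OF this, of "s - 1"]]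
  have "(\<lambda>m. zeta_summand 1 s (of_nat m + v) - (p (Suc m) - p m) / (s - 1)) sums gregory_zeta v s"
    using v s by (simp add: gregory_zeta_def p_def add.commute)
  moreover have "zeta_summand 1 s (of_nat m + v) - (p (Suc m) - p m) / (s - 1) = (of_nat m + v) powr (- s)" for m
    by (simp add: zeta_summand_def zeta_coeff_def p_def add_ac diff_divide_distrib)
  ultimately show ?thesis by simp
qed

lemma holomorphic_gregory_zeta:
  assumes v: "Re v > 0"
  shows "gregory_zeta v holomorphic_on (- {1})"
  unfolding gregory_zeta_def using v
  by (intro holomorphic_intros holomorphic_suminf_zeta_diff summable_gregory_abs gregory_abs_nonneg) auto

text \<open>The definite description is met by \<open>gregory_zeta\<close>, and uniquely so by the
  identity theorem on the connected punctured plane.\<close>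

lemma hurwitz_zeta_eq_gregory_zeta:
  assumes v: "Re v > 0" and s: "s \<noteq> 1"
  shows "hurwitz_zeta s v = gregory_zeta v s"
proof -
  \<comment> \<open>At 1 the formula involves division by zero, so the value there is set to satisfy
    the clause \<open>f 1 = 0\<close>.\<close>
  define Z where "Z = (\<lambda>s. if s = 1 then 0 else gregory_zeta v s)"
  have "(THE f. f holomorphic_on (- {1}) \<and> f 1 = 0 \<and>
        (\<forall>z. Re z > 1 \<longrightarrow> (\<lambda>n. (of_nat n + v) powr (- z)) sums f z)) = Z"
  proof (rule the_equality)
    have Z: "Z holomorphic_on (- {1})"
      using holomorphic_gregory_zeta[OF v] by (rule holomorphic_transform) (simp add: Z_def)
    have Z_sums: "(\<lambda>n. (of_nat n + v) powr (- z)) sums Z z" if "Re z > 1" for z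
      using gregory_zeta_sums[OF v that] that by (auto simp: Z_def)
    show "Z holomorphic_on (- {1}) \<and> Z 1 = 0 \<and>
        (\<forall>z. Re z > 1 \<longrightarrow> (\<lambda>n. (of_nat n + v) powr (- z)) sums Z z)"
      using Z Z_sums by (simp add: Z_def)
    fix f assume f: "f holomorphic_on (- {1}) \<and> f 1 = 0 \<and>
        (\<forall>z. Re z > 1 \<longrightarrow> (\<lambda>n. (of_nat n + v) powr (- z)) sums f z)"
    have "f z = Z z" if "z \<noteq> 1" for z
    proof (rule analytic_continuation_open[of "{z. Re z > 1}" "- {1}" f Z])
      show "open {z. Re z > 1}" by (rule open_halfspace_Re_gt)
      show "{z. Re z > 1} \<noteq> {}" by (auto intro!: exI[of _ 2])
      show "connected (- {1::complex})"
        by (rule connected_punctured_universe) simp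
      show "f z = Z z" if "z \<in> {z. Re z > 1}" for z
        using f Z_sums[of z] that sums_unique2 by blast
    qed (use f Z that in auto)
    thus "f = Z" using f by (auto simp: fun_eq_iff Z_def)
  qed
  thus ?thesis using s by (simp add: hurwitz_zeta_def Z_def)
qed

lemma hurwitz_zeta_sums:
  assumes "Re v > 0" and "Re s > 1"
  shows "(\<lambda>m. (of_nat m + v) powr (- s)) sums hurwitz_zeta s v"
  using gregory_zeta_sums[OF assms] hurwitz_zeta_eq_gregory_zeta[OF assms(1), of s] assms(2) by force

lemma holomorphic_hurwitz_zeta:
  assumes v: "Re v > 0"
  shows "(\<lambda>s. hurwitz_zeta s v) holomorphic_on (- {1})"
  using holomorphic_gregory_zeta[OF v]
  by (rule holomorphic_transform) (simp add: hurwitz_zeta_eq_gregory_zeta[OF v])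

section \<open>The identity for Hurwitz zeta values and its continuation\<close>

text \<open>Summing \<open>zeta_summand\<close> over the shifts of \<open>v\<close> piece by piece;
  \<open>Re s > k + 1\<close> makes the Dirichlet series of every \<open>s - l\<close> with
  \<open>l \<le> k\<close> converge.\<close>

lemma hurwitz_zeta_gregory_half_plane:
  assumes k: "k \<ge> 1" and v: "Re v > 0" and s: "Re s > real k + 1"
  shows "hurwitz_zeta s v + (\<Sum>l=1..k-1. zeta_coeff k l s * hurwitz_zeta (s - of_nat l) v)
      - (\<Sum>l=1..k. zeta_coeff k l s * v powr (of_nat l - s))
    = of_nat k * (\<Sum>n. of_real (gregory_abs k n) * zeta_diff n s v)"
proof -
  have sums: "(\<lambda>m. (of_nat m + v) powr (of_nat l - s)) sums hurwitz_zeta (s - of_nat l) v" if "l \<le> k" for l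
    using hurwitz_zeta_sums[OF v, of "s - of_nat l"] s that by simp
  have sums': "(\<lambda>m. (of_nat m + v + 1) powr (of_nat l - s)) sums
      (hurwitz_zeta (s - of_nat l) v - v powr (of_nat l - s))" if "l \<le> k" for l
    using sums[OF that] sums_Suc_iff[of "\<lambda>m. (of_nat m + v) powr (of_nat l - s)"]
    by (simp add: add_ac)
  have "(\<lambda>m. zeta_summand k s (of_nat m + v)) sums
     (hurwitz_zeta s v - zeta_coeff k k s * hurwitz_zeta (s - of_nat k) v
      + (\<Sum>l=1..k. zeta_coeff k l s * (hurwitz_zeta (s - of_nat l) v - v powr (of_nat l - s))))"
    unfolding zeta_summand_def
    by (intro sums_add sums_diff sums_mult sums_sum sums sums' hurwitz_zeta_sums v) (use s in auto)
  moreover have "(\<lambda>m. zeta_summand k s (of_nat m + v)) sums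
    (of_nat k * (\<Sum>n. of_real (gregory_abs k n) * zeta_diff n s v))"
    by (rule zeta_summand_sums[OF k _ v]) (use s in simp)
  ultimately have "of_nat k * (\<Sum>n. of_real (gregory_abs k n) * zeta_diff n s v) =
      hurwitz_zeta s v - zeta_coeff k k s * hurwitz_zeta (s - of_nat k) v
      + (\<Sum>l=1..k. zeta_coeff k l s * (hurwitz_zeta (s - of_nat l) v - v powr (of_nat l - s)))"
    using sums_unique2 by blast
  moreover have "(\<Sum>l=1..k. zeta_coeff k l s * (hurwitz_zeta (s - of_nat l) v - v powr (of_nat l - s)))
     = (\<Sum>l=1..k. zeta_coeff k l s * hurwitz_zeta (s - of_nat l) v)
       - (\<Sum>l=1..k. zeta_coeff k l s * v powr (of_nat l - s))"
    by (simp add: right_diff_distrib sum_subtractf)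
  \<comment> \<open>The last term cancels the separate \<open>zeta_coeff k k s\<close> contribution,
    which is why the zeta values stop at \<open>k - 1\<close>.\<close>
  moreover have "(\<Sum>l=1..k. zeta_coeff k l s * hurwitz_zeta (s - of_nat l) v)
    = (\<Sum>l=1..k-1. zeta_coeff k l s * hurwitz_zeta (s - of_nat l) v)
      + zeta_coeff k k s * hurwitz_zeta (s - of_nat k) v"
    using k by (cases k) auto
  ultimately show ?thesis by simp
qed

text \<open>The denominator vanishes only at the integers from 1 to \<open>l\<close>, all of which
  are excluded.\<close>

lemma holomorphic_zeta_coeff:
  assumes "l \<le> k"
  shows "zeta_coeff k l holomorphic_on - of_nat ` {1..k}"
proof -
  have "pochhammer (s - of_nat l) l \<noteq> 0" if "s \<in> - of_nat ` {1..k}" for s :: complex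
  proof
    assume "pochhammer (s - of_nat l) l = 0"
    then obtain i where "i < l" "s - of_nat l = - of_nat i"
      by (auto simp: pochhammer_eq_0_iff)
    hence "s = of_nat (l - i)" "l - i \<in> {1..k}" 
      using assms by (auto simp: of_nat_diff algebra_simps)
    thus False using that by blast
  qed
  moreover have "(\<lambda>s::complex. pochhammer (s - of_nat l) l) holomorphic_on - of_nat ` {1..k}"
    unfolding pochhammer_prod by (intro holomorphic_intros)
  ultimately show ?thesis
    unfolding zeta_coeff_def by (intro holomorphic_intros) auto
qed

text \<open>Both sides are holomorphic off the finite set of integers from 1 to \<open>k\<close>,
  whose complement is connected, and they agree on a half-plane.\<close>

lemma hurwitz_zeta_gregory:
  assumes k: "k \<ge> 1" and v: "Re v > 0" and s: "s \<notin> of_nat ` {1..k}"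
  shows "hurwitz_zeta s v + (\<Sum>l=1..k-1. zeta_coeff k l s * hurwitz_zeta (s - of_nat l) v)
      - (\<Sum>l=1..k. zeta_coeff k l s * v powr (of_nat l - s))
    = of_nat k * (\<Sum>n. of_real (gregory_abs k n) * zeta_diff n s v)"
proof (rule analytic_continuation_open[of "{s. Re s > real k + 1}" "- of_nat ` {1..k}"
      "\<lambda>s. hurwitz_zeta s v + (\<Sum>l=1..k-1. zeta_coeff k l s * hurwitz_zeta (s - of_nat l) v)
        - (\<Sum>l=1..k. zeta_coeff k l s * v powr (of_nat l - s))"])
  show "open {s. Re s > real k + 1}" by (rule open_halfspace_Re_gt)
  show "open (- of_nat ` {1..k} :: complex set)" by (intro open_Compl finite_imp_closed) auto
  show "{s. Re s > real k + 1} \<noteq> {}" by (auto intro!: exI[of _ "of_nat k + 2"])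
  show "connected (- of_nat ` {1..k} :: complex set)"
    using connected_open_diff_countable[of "UNIV :: complex set" "of_nat ` {1..k}"]
    by (simp add: Compl_eq_Diff_UNIV connected_UNIV)
  show "{s. Re s > real k + 1} \<subseteq> - of_nat ` {1..k}" by auto
  \<comment> \<open>The point to avoid is \<open>s = Suc l\<close>, an excluded integer because
    \<open>l < k\<close>; the case \<open>l = 0\<close> covers the leading zeta value.\<close>
  have shift: "(\<lambda>s. hurwitz_zeta (s - of_nat l) v) holomorphic_on - of_nat ` {1..k}" if "l < k" for l
  proof (rule holomorphic_on_compose_gen[OF _ holomorphic_hurwitz_zeta[OF v], unfolded o_def])
    show "(\<lambda>s. s - of_nat l) ` (- of_nat ` {1..k}) \<subseteq> - {1::complex}"
    proof safe
      fix s :: complex assume s: "s \<notin> of_nat ` {1..k}" "s - of_nat l = 1"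
      hence "s = of_nat (Suc l)" by (simp add: algebra_simps)
      moreover have "Suc l \<in> {1..k}" using that by simp
      ultimately show False using s by blast
    qed
  qed (intro holomorphic_intros)
  show "(\<lambda>s. hurwitz_zeta s v + (\<Sum>l=1..k-1. zeta_coeff k l s * hurwitz_zeta (s - of_nat l) v)
        - (\<Sum>l=1..k. zeta_coeff k l s * v powr (of_nat l - s))) holomorphic_on - of_nat ` {1..k}"
    using shift[of 0] k by (intro holomorphic_intros holomorphic_zeta_coeff shift) auto
  show "(\<lambda>s. of_nat k * (\<Sum>n. of_real (gregory_abs k n) * zeta_diff n s v)) holomorphic_on - of_nat ` {1..k}"
    using v k by (intro holomorphic_intros holomorphic_suminf_zeta_diff summable_gregory_abs gregory_abs_nonneg)
qed (use s hurwitz_zeta_gregory_half_plane[OF k v] in auto)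

text \<open>Splitting off the last factors of both Pochhammer symbols relates the sum for
  \<open>Suc k\<close> at \<open>s\<close> to the one for \<open>k\<close> at \<open>s - 1\<close>,
  whose extra term \<open>l = 0\<close> is 1.\<close>

lemma sum_zeta_coeff:
  assumes "s \<notin> of_nat ` {1..k}"
  shows "(\<Sum>l=1..k. zeta_coeff k l s) = of_nat k / (s - of_nat k)"
  using assms
proof (induction k arbitrary: s)
  case (Suc k)
  have not: "s \<noteq> of_nat i" if "i \<in> {1..Suc k}" for i using Suc.prems that by blast
  have "s - 1 \<notin> of_nat ` {1..k}"
  proof
    assume "s - 1 \<in> of_nat ` {1..k}"
    then obtain i where "i \<in> {1..k}" "s = of_nat (Suc i)" by (auto simp: algebra_simps)
    thus False using not[of "Suc i"] by auto
  qed
  note IH = Suc.IH[OF this]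
  have coeff: "zeta_coeff (Suc k) (Suc l) s = of_nat (Suc k) / (s - 1) * zeta_coeff k l (s - 1)" for l
    by (simp add: zeta_coeff_def pochhammer_Suc algebra_simps)
  have "(\<Sum>l=1..Suc k. zeta_coeff (Suc k) l s) = (\<Sum>l=0..k. zeta_coeff (Suc k) (Suc l) s)"
    using sum.shift_bounds_cl_Suc_ivl[of "\<lambda>l. zeta_coeff (Suc k) l s" 0 k] by simp
  also have "\<dots> = of_nat (Suc k) / (s - 1) * (\<Sum>l=0..k. zeta_coeff k l (s - 1))"
    by (simp add: coeff sum_distrib_left)
  also have "(\<Sum>l=0..k. zeta_coeff k l (s - 1)) = 1 + of_nat k / (s - 1 - of_nat k)"
    by (subst sum.atLeast_Suc_atMost) (use IH in \<open>auto simp: zeta_coeff_def\<close>)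
  also have "\<dots> = (s - 1) / (s - of_nat (Suc k))"
    using not[of "Suc k"] by (simp add: field_simps)
  also have "of_nat (Suc k) / (s - 1) * \<dots> = of_nat (Suc k) / (s - of_nat (Suc k))"
    using not[of 1] by simp
  finally show ?case .
qed simp

theorem theorem4:
  fixes k :: nat and s :: complex
  assumes "k \<ge> 2" and "s \<notin> of_nat ` {1..k}"
  shows "(\<forall>v::complex. Re v > 0 \<longrightarrow>
      summable (\<lambda>n. (-1) ^ n * complex_of_real (gregory_coeff k (n + 1)) *
        (\<Sum>j=0..n. (-1) ^ j * of_nat (n choose j) * (of_nat j + v) powr (- s))) \<and>
      hurwitz_zeta s v =
        - (\<Sum>l=1..k-1. pochhammer (of_nat k - of_nat l + 1) l / pochhammer (s - of_nat l) l
             * hurwitz_zeta (s - of_nat l) v)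
        + (\<Sum>l=1..k. pochhammer (of_nat k - of_nat l + 1) l / pochhammer (s - of_nat l) l
             * v powr (of_nat l - s))
        + of_nat k * (\<Sum>n. (-1) ^ n * complex_of_real (gregory_coeff k (n + 1)) *
            (\<Sum>j=0..n. (-1) ^ j * of_nat (n choose j) * (of_nat j + v) powr (- s))))
    \<and>
      summable (\<lambda>n. (-1) ^ n * complex_of_real (gregory_coeff k (n + 1)) *
        (\<Sum>j=0..n. (-1) ^ j * of_nat (n choose j) * (of_nat j + 1) powr (- s))) \<and>
      riemann_zeta s =
        - (\<Sum>l=1..k-1. pochhammer (of_nat k - of_nat l + 1) l / pochhammer (s - of_nat l) l
             * riemann_zeta (s - of_nat l))
        + of_nat k / (s - of_nat k)
        + of_nat k * (\<Sum>n. (-1) ^ n * complex_of_real (gregory_coeff k (n + 1)) *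
            (\<Sum>j=0..n. (-1) ^ j * of_nat (n choose j) * (of_nat j + 1) powr (- s)))"
proof -
  have k: "k \<ge> 1" using assms by simp
  have abs: "(-1) ^ n * complex_of_real (gregory_coeff k (n + 1)) = of_real (gregory_abs k n)" for n
    by (simp add: gregory_abs_def)
  have summable: "summable (\<lambda>n. of_real (gregory_abs k n) * zeta_diff n s v)" if "Re v > 0" for v
    by (rule summable_zeta_diff[OF that summable_gregory_abs[OF k] gregory_abs_nonneg[OF k]])
  have eq: "hurwitz_zeta s v = - (\<Sum>l=1..k-1. zeta_coeff k l s * hurwitz_zeta (s - of_nat l) v)
      + (\<Sum>l=1..k. zeta_coeff k l s * v powr (of_nat l - s))
      + of_nat k * (\<Sum>n. of_real (gregory_abs k n) * zeta_diff n s v)" if "Re v > 0" for v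
    using hurwitz_zeta_gregory[OF k that assms(2)] by (simp add: algebra_simps)
  \<comment> \<open>At \<open>v = 1\<close> all powers are 1, so the middle sum collapses to a
    single fraction.\<close>
  have "(\<Sum>l=1..k. zeta_coeff k l s * 1 powr (of_nat l - s)) = of_nat k / (s - of_nat k)"
    using sum_zeta_coeff[OF assms(2)] by simp
  with eq[of 1] summable eq show ?thesis
    unfolding abs riemann_zeta_def zeta_diff_def[symmetric] zeta_coeff_def[symmetric] by simp
qed

end
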